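(* Let $\mathcal{P}$ be a hereditary property of tournaments, and suppose that $k = k(\mathcal{P}) < \infty$. Then $|\mathcal{P}_n| = \Theta(n^k)$.
   Context: Tournaments are unlabelled; a hereditary property of tournaments is a class closed under isomorphism and induced sub-tournaments, and $\mathcal{P}_n$ is its set of members on $n$ vertices. In a tournament $T$, for vertices $u,v$ write $u \curvearrowright v$ if $u \to v$ and there exist $k \geq 0$ and vertices $w_1,\ldots,w_k$ such that, with $C(u,v) = \{u,w_1,\ldots,w_k,v\}$: (i) $u \to w_i \to v$ for all $i$; (ii) $w_i \to w_j$ for $i<j$; (iii) for every $x \in V(T)\setminus C(u,v)$ and $y,z \in C(u,v)$, $x \to y$ iff $x \to z$. Write $u \sim v$ if $u = v$, $u \curvearrowright v$ or $v \curvearrowright u$. This is an equivalence relation; its classes are the homogeneous blocks of $T$. Define $k(\mathcal{P}) = \sup\{\ell : \text{for every } m \in \mathbb{N} \text{ there exists } T \in \mathcal{P} \text{ whose } (\ell+1)\text{-st largest homogeneous block has at least } m \text{ elements}\}$. *)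

theory Defs
  imports
    "Graph_Theory.Pair_Digraph"
    "Graph_Theory.Digraph_Isomorphism"
    "HOL-Library.Extended_Real"
    "HOL-Library.Landau_Symbols"
    "HOL-Library.Multiset"
begin

locale tournament = pair_digraph +
  assumes tournament_arcs:
    "\<lbrakk>u \<in> pverts G; v \<in> pverts G; u \<noteq> v\<rbrakk> \<Longrightarrow> (u, v) \<in> parcs G \<longleftrightarrow> (v, u) \<notin> parcs G"

text \<open>
  A class of (finite) tournaments closed under isomorphism is represented by its members
  with vertices in \<^typ>\<open>nat\<close>; every finite tournament has an isomorphic copy there.
  The null tournament may, but need not, belong to a hereditary property.
\<close>

definition hereditary_property :: "nat pair_pre_digraph set \<Rightarrow> bool" where
  "hereditary_property P \<longleftrightarrow>
     (\<forall>T\<in>P. tournament T) \<and>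
     (\<forall>T\<in>P. \<forall>H :: nat pair_pre_digraph.
        digraph_iso (with_proj T) (with_proj H) \<longrightarrow> H \<in> P) \<and>
     (\<forall>T\<in>P. \<forall>H :: nat pair_pre_digraph.
        induced_subgraph (with_proj H) (with_proj T) \<and> pverts H \<noteq> {} \<longrightarrow> H \<in> P)"

definition iso_rel :: "nat pair_pre_digraph rel" where
  "iso_rel = {(T, H). digraph_iso (with_proj T) (with_proj H)}"

text \<open>Tournaments are unlabelled, so the members on \<open>n\<close> vertices are isomorphism classes.\<close>

definition level :: "nat pair_pre_digraph set \<Rightarrow> nat \<Rightarrow> nat pair_pre_digraph set set" where
  "level P n = {T \<in> P. card (pverts T) = n} // iso_rel"

definition homog_arc :: "'a pair_pre_digraph \<Rightarrow> 'a \<Rightarrow> 'a \<Rightarrow> bool" where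
  "homog_arc T u v \<longleftrightarrow>
     (u, v) \<in> parcs T \<and>
     (\<exists>ws. set ws \<subseteq> pverts T \<and>
        (let C = {u, v} \<union> set ws in
           (\<forall>w\<in>set ws. (u, w) \<in> parcs T \<and> (w, v) \<in> parcs T) \<and>
           sorted_wrt (\<lambda>x y. (x, y) \<in> parcs T) ws \<and>
           (\<forall>x\<in>pverts T - C. \<forall>y\<in>C. \<forall>z\<in>C. (x, y) \<in> parcs T \<longleftrightarrow> (x, z) \<in> parcs T)))"

definition homog_rel :: "'a pair_pre_digraph \<Rightarrow> 'a rel" where
  "homog_rel T =
     {(u, v) \<in> pverts T \<times> pverts T. u = v \<or> homog_arc T u v \<or> homog_arc T v u}"

definition homogeneous_blocks :: "'a pair_pre_digraph \<Rightarrow> 'a set set" where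
  "homogeneous_blocks T = pverts T // homog_rel T"

text \<open>
  The block sizes, with multiplicity, in non-increasing order; the \<open>(l + 1)\<close>-st largest one
  is at position \<open>l\<close>.
\<close>

definition block_sizes :: "'a pair_pre_digraph \<Rightarrow> nat list" where
  "block_sizes T =
     rev (sorted_list_of_multiset (image_mset card (mset_set (homogeneous_blocks T))))"

text \<open>
  The supremum is taken in the extended reals: it is \<open>\<infinity>\<close> if unbounded and \<open>-\<infinity>\<close> if no
  \<open>l\<close> qualifies (which happens when the tournaments in \<open>P\<close> have bounded order).
\<close>

definition block_number :: "nat pair_pre_digraph set \<Rightarrow> ereal" where
  "block_number P =
     (SUP l\<in>{l :: nat. \<forall>m :: nat. \<exists>T\<in>P. l < length (block_sizes T) \<and> m \<le> block_sizes T ! l}.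
        ereal (real l))"

end

theory Submission
  imports Defs
begin

text \<open>
  Two vertices lie in the same homogeneous block iff some transitive module (a set without cyclic
  triangles that no outside vertex distinguishes) contains both. The heart of the matter is that a
  tournament with many blocks has a sub-tournament with many large blocks. To see this, pass to one
  vertex per block and take a longest chain. Any two consecutive chain vertices \<open>a, b\<close> are
  distinguished by some \<open>z\<close>, and by maximality of the chain there is \<open>u\<close> such that \<open>{a, b, z, u}\<close>
  contains a cyclic triangle which keeps \<open>a\<close> and \<open>b\<close> in different blocks whenever \<open>z\<close> and \<open>u\<close> are
  present. Choose a few consecutive pairs far apart; by the pigeonhole principle the chain has,
  between them, long stretches of vertices that look alike to all the chosen \<open>z, u\<close>. These stretches are
  transitive modules of the sub-tournament they span with the chosen pairs and the \<open>z, u\<close>,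
  and the pairs keep them in different blocks.

  Hence, if \<open>k\<close> is finite, the members of the property have boundedly many blocks, all but \<open>k + 1\<close> of
  which have bounded size. Since a tournament is determined by the arcs between its blocks and by
  the block sizes, and the sizes add up to \<open>n\<close>, there are \<open>O(n\<^sup>k)\<close> of them. Conversely,
  shrinking \<open>k + 1\<close> huge blocks to prescribed sizes leaves the block structure intact, and
  choosing the sizes from disjoint ranges of length proportional to \<open>n\<close> gives pairwise
  non-isomorphic members.
\<close>

section \<open>Blocks as transitive modules\<close>

text \<open>The arc relation and the vertex set are kept apart, so that passing to a sub-tournament
  shrinks \<open>S\<close> and leaves \<open>A\<close> alone; arcs of \<open>A\<close> that leave
  \<open>S\<close> are unconstrained.\<close>

definition tournament_on :: "'a rel \<Rightarrow> 'a set \<Rightarrow> bool" where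
  "tournament_on A S \<longleftrightarrow>
     (\<forall>x\<in>S. (x, x) \<notin> A) \<and> (\<forall>x\<in>S. \<forall>y\<in>S. x \<noteq> y \<longrightarrow> ((x, y) \<in> A \<longleftrightarrow> (y, x) \<notin> A))"

text \<open>Stated as the absence of cyclic triangles; inside a tournament this amounts to
  transitivity, which \<open>transitive_setD\<close> recovers.\<close>

definition transitive_set :: "'a rel \<Rightarrow> 'a set \<Rightarrow> bool" where
  "transitive_set A C \<longleftrightarrow>
     (\<forall>x\<in>C. \<forall>y\<in>C. \<forall>z\<in>C. (x, y) \<in> A \<and> (y, z) \<in> A \<longrightarrow> (z, x) \<notin> A)"

text \<open>These are the modules (intervals, homogeneous sets) of modular decomposition, restricted
  to transitive ones. They replace the sets \<open>C(u,v)\<close>, which come with two endpoints and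
  an ordering.\<close>

definition transitive_module :: "'a rel \<Rightarrow> 'a set \<Rightarrow> 'a set \<Rightarrow> bool" where
  "transitive_module A S C \<longleftrightarrow> C \<subseteq> S \<and> transitive_set A C \<and>
     (\<forall>x\<in>S - C. \<forall>y\<in>C. \<forall>z\<in>C. (x, y) \<in> A \<longleftrightarrow> (x, z) \<in> A)"

definition same_block :: "'a rel \<Rightarrow> 'a set \<Rightarrow> 'a rel" where
  "same_block A S = {(x, y). \<exists>C. transitive_module A S C \<and> x \<in> C \<and> y \<in> C}"

lemma tournament_on_subset: "tournament_on A S \<Longrightarrow> R \<subseteq> S \<Longrightarrow> tournament_on A R"
  by (auto simp: tournament_on_def)

lemma tournament_on_irrefl: "tournament_on A S \<Longrightarrow> x \<in> S \<Longrightarrow> (x, x) \<notin> A"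
  by (auto simp: tournament_on_def)

lemma tournament_on_swap:
  "tournament_on A S \<Longrightarrow> x \<in> S \<Longrightarrow> y \<in> S \<Longrightarrow> x \<noteq> y \<Longrightarrow> (x, y) \<in> A \<longleftrightarrow> (y, x) \<notin> A"
  unfolding tournament_on_def by blast

lemma transitive_set_subset: "transitive_set A C \<Longrightarrow> D \<subseteq> C \<Longrightarrow> transitive_set A D"
  unfolding transitive_set_def by blast

lemma transitive_set_no_cycle:
  "transitive_set A C \<Longrightarrow> x \<in> C \<Longrightarrow> y \<in> C \<Longrightarrow> z \<in> C \<Longrightarrow>
     (x, y) \<in> A \<Longrightarrow> (y, z) \<in> A \<Longrightarrow> (z, x) \<notin> A"
  unfolding transitive_set_def by meson

lemma transitive_setD:
  assumes "tournament_on A S" "transitive_set A C" "C \<subseteq> S"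
    and "x \<in> C" "y \<in> C" "z \<in> C" "(x, y) \<in> A" "(y, z) \<in> A"
  shows "(x, z) \<in> A"
proof -
  have xyz: "x \<in> S" "y \<in> S" "z \<in> S"
    using assms(3-6) by blast+
  then have "(y, x) \<notin> A"
    using assms(7) tournament_on_irrefl[OF assms(1)] tournament_on_swap[OF assms(1), of x y] xyz by metis
  then have "x \<noteq> z"
    using assms(8) by blast
  moreover have "(z, x) \<notin> A"
    using transitive_set_no_cycle[OF assms(2,4-)] .
  ultimately show ?thesis
    using tournament_on_swap[OF assms(1) xyz(1,3)] by metis
qed

lemma transitive_moduleD:
  assumes "transitive_module A S C"
  shows "C \<subseteq> S" "transitive_set A C"
    and "x \<in> S \<Longrightarrow> x \<notin> C \<Longrightarrow> y \<in> C \<Longrightarrow> z \<in> C \<Longrightarrow> (x, y) \<in> A \<longleftrightarrow> (x, z) \<in> A"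
  using assms unfolding transitive_module_def by (blast, blast, meson DiffI)

lemma transitive_module_swap:
  assumes "tournament_on A S" "transitive_module A S C"
    and "x \<in> S" "x \<notin> C" "y \<in> C" "z \<in> C"
  shows "(y, x) \<in> A \<longleftrightarrow> (z, x) \<in> A"
proof -
  have "y \<in> S" "z \<in> S" "x \<noteq> y" "x \<noteq> z"
    using assms transitive_moduleD(1)[OF assms(2)] by auto
  then show ?thesis
    using tournament_on_swap[OF assms(1)] transitive_moduleD(3)[OF assms(2), of x y z] assms(3-) by metis
qed

lemma transitive_module_singleton:
  "tournament_on A S \<Longrightarrow> x \<in> S \<Longrightarrow> transitive_module A S {x}"
  unfolding transitive_module_def transitive_set_def tournament_on_def by auto

text \<open>An outside vertex sees all of \<open>C\<close> and all of \<open>D\<close> as it sees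
  \<open>c\<close>. A cyclic triangle in the union that lies in neither module has two vertices in
  one of them and the third outside it; this third vertex has an arc to one of the two and an arc
  from the other, so it distinguishes them.\<close>

lemma transitive_module_Un:
  assumes T: "tournament_on A S" and C: "transitive_module A S C" and D: "transitive_module A S D"
    and c: "c \<in> C" "c \<in> D"
  shows "transitive_module A S (C \<union> D)"
  unfolding transitive_module_def
proof (intro conjI ballI)
  show "C \<union> D \<subseteq> S"
    using C D by (auto simp: transitive_module_def)
  fix x y z assume "x \<in> S - (C \<union> D)" "y \<in> C \<union> D" "z \<in> C \<union> D"
  then show "(x, y) \<in> A \<longleftrightarrow> (x, z) \<in> A"
    using transitive_moduleD(3)[OF C, of x] transitive_moduleD(3)[OF D, of x] c by blast
next
  note sub = transitive_moduleD(1)[OF C] transitive_moduleD(1)[OF D]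
  have no_cycle: False
    if C': "transitive_module A S C'" and D': "transitive_module A S D'"
      and "x \<in> C'" "y \<in> C'" "z \<in> D' - C'"
      and cyc: "(x, y) \<in> A" "(y, z) \<in> A" "(z, x) \<in> A" for C' D' x y z
  proof -
    have "z \<in> S" "y \<in> S" "y \<noteq> z" using that transitive_moduleD(1)[OF C'] transitive_moduleD(1)[OF D'] by auto
    then have "(z, y) \<notin> A" using tournament_on_swap[OF T, of y z] cyc by blast
    with transitive_moduleD(3)[OF C', of z x y] that \<open>z \<in> S\<close> show False by blast
  qed
  show "transitive_set A (C \<union> D)"
    unfolding transitive_set_def
  proof (intro ballI impI notI)
    fix x y z
    assume xyz: "x \<in> C \<union> D" "y \<in> C \<union> D" "z \<in> C \<union> D"
      and a: "(x, y) \<in> A \<and> (y, z) \<in> A" "(z, x) \<in> A"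
    have C3: "\<not> (x \<in> C \<and> y \<in> C \<and> z \<in> C)" and D3: "\<not> (x \<in> D \<and> y \<in> D \<and> z \<in> D)"
      using a transitive_moduleD(2)[OF C] transitive_moduleD(2)[OF D] unfolding transitive_set_def by metis+
    have C2: "\<not> (x \<in> C \<and> y \<in> C \<and> z \<in> D - C)" "\<not> (y \<in> C \<and> z \<in> C \<and> x \<in> D - C)"
        "\<not> (z \<in> C \<and> x \<in> C \<and> y \<in> D - C)"
      using no_cycle[OF C D] a by metis+
    have D2: "\<not> (x \<in> D \<and> y \<in> D \<and> z \<in> C - D)" "\<not> (y \<in> D \<and> z \<in> D \<and> x \<in> C - D)"
        "\<not> (z \<in> D \<and> x \<in> D \<and> y \<in> C - D)"
      using no_cycle[OF D C] a by metis+
    show False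
      using xyz C3 D3 C2 D2 unfolding Un_iff Diff_iff by argo
  qed
qed

lemma equiv_same_block:
  assumes T: "tournament_on A S"
  shows "equiv S (same_block A S)"
proof (rule equivI)
  show "same_block A S \<subseteq> S \<times> S"
    by (auto simp: same_block_def transitive_module_def)
  show "refl_on S (same_block A S)"
    using transitive_module_singleton[OF T]
    unfolding refl_on_def same_block_def by blast
  show "sym (same_block A S)"
    unfolding sym_def same_block_def by blast
  show "trans (same_block A S)"
    unfolding trans_def same_block_def
    using transitive_module_Un[OF T] by (smt (verit) Un_iff case_prodD case_prodI mem_Collect_eq)
qed

text \<open>Being a transitive module constrains at most three members of the block at a time. Hence
  it is enough to use a module through a given pair, or the union of two such modules that share a
  vertex.\<close>

lemma transitive_module_block:
  assumes T: "tournament_on A S" and B: "B \<in> S // same_block A S"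
  shows "transitive_module A S B"
proof -
  note eq = equiv_same_block[OF T]
  have sub: "B \<subseteq> S" using in_quotient_imp_subset[OF eq B] .
  have rel: "(x, y) \<in> same_block A S" if "x \<in> B" "y \<in> B" for x y
    using quotient_eq_iff[OF eq B B that] by simp
  have closed: "y \<in> B" if "x \<in> B" "(x, y) \<in> same_block A S" for x y
    using in_quotient_imp_closed[OF eq B that] .
  show ?thesis
    unfolding transitive_module_def
  proof (intro conjI ballI)
    show "B \<subseteq> S" by fact
    show "transitive_set A B"
      unfolding transitive_set_def
    proof (intro ballI impI)
      fix x y z assume "x \<in> B" "y \<in> B" "z \<in> B" and a: "(x, y) \<in> A \<and> (y, z) \<in> A"
      then obtain C D where CD: "transitive_module A S C" "x \<in> C" "y \<in> C"
          "transitive_module A S D" "y \<in> D" "z \<in> D"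
        using rel[of x y] rel[of y z] by (auto simp: same_block_def)
      have "transitive_set A (C \<union> D)"
        using transitive_moduleD(2)[OF transitive_module_Un[OF T CD(1,4,3,5)]] .
      then show "(z, x) \<notin> A"
        using CD a unfolding transitive_set_def by blast
    qed
    fix x y z assume x: "x \<in> S - B" and "y \<in> B" "z \<in> B"
    then obtain C where C: "transitive_module A S C" "y \<in> C" "z \<in> C"
      using rel[of y z] by (auto simp: same_block_def)
    have "x \<notin> C"
      using closed[of y x] C x \<open>y \<in> B\<close> by (auto simp: same_block_def)
    with C x show "(x, y) \<in> A \<longleftrightarrow> (x, z) \<in> A"
      using transitive_moduleD(3)[OF C(1)] by blast
  qed
qed

lemma transitive_list:
  assumes "finite C" "tournament_on A C" "transitive_set A C"
  obtains xs where "set xs = C" "distinct xs" "sorted_wrt (\<lambda>x y. (x, y) \<in> A) xs"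
proof -
  have "\<exists>xs. set xs = C \<and> distinct xs \<and> sorted_wrt (\<lambda>x y. (x, y) \<in> A) xs"
    using assms
  proof (induction C rule: finite_induct)
    case empty
    show ?case by simp
  next
    case (insert c C)
    then obtain xs where xs: "set xs = C" "distinct xs" "sorted_wrt (\<lambda>x y. (x, y) \<in> A) xs"
      by (meson subset_insertI tournament_on_subset transitive_set_subset)
    \<comment> \<open>The new vertex is placed after its in-neighbours; transitivity through
      \<open>c\<close> then supplies the arcs from the first part to the last.\<close>
    let ?ys = "filter (\<lambda>x. (x, c) \<in> A) xs @ [c] @ filter (\<lambda>x. (x, c) \<notin> A) xs"
    have out: "(c, x) \<in> A" if "x \<in> C" "(x, c) \<notin> A" for x
      using that insert tournament_on_swap[OF insert.prems(1), of c x] by auto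
    then have "(x, y) \<in> A" if "x \<in> C" "y \<in> C" "(x, c) \<in> A" "(y, c) \<notin> A" for x y
      using transitive_setD[OF insert.prems(1,2) order.refl, of x c y] that by blast
    with out xs have "sorted_wrt (\<lambda>x y. (x, y) \<in> A) ?ys"
      by (auto simp: sorted_wrt_append sorted_wrt_filter)
    moreover have "set ?ys = insert c C" "distinct ?ys"
      using xs insert.hyps by auto
    ultimately show ?case by blast
  qed
  then show ?thesis using that by blast
qed

section \<open>The given block relation coincides with the one defined by modules\<close>

lemma tournament_tournament_on:
  assumes "tournament T"
  shows "tournament_on (parcs T) (pverts T)"
proof -
  interpret tournament T by fact
  show ?thesis
    unfolding tournament_on_def using no_loops' tournament_arcs by blast
qed

lemma tournament_finite:
  assumes "tournament T"
  shows "finite (pverts T)"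
proof -
  interpret tournament T by fact
  show ?thesis by (rule pair_finite_verts)
qed

lemma tournament_arcs_subset:
  assumes "tournament T"
  shows "parcs T \<subseteq> pverts T \<times> pverts T"
proof -
  interpret tournament T by fact
  show ?thesis using in_arcsD1 in_arcsD2 by auto
qed

text \<open>Listed as \<open>u\<close>, \<open>ws\<close>, \<open>v\<close>, the set
  \<open>C(u,v)\<close> has all its arcs pointing forward. Positions increase along arcs, so no
  cyclic triangle can close up.\<close>

lemma homog_arc_transitive_module:
  assumes T: "tournament_on (parcs T) (pverts T)" and sub: "parcs T \<subseteq> pverts T \<times> pverts T"
    and uv: "homog_arc T u v"
  shows "(u, v) \<in> same_block (parcs T) (pverts T)"
proof -
  obtain ws where ws: "set ws \<subseteq> pverts T" "(u, v) \<in> parcs T"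
    "\<forall>w\<in>set ws. (u, w) \<in> parcs T \<and> (w, v) \<in> parcs T"
    "sorted_wrt (\<lambda>x y. (x, y) \<in> parcs T) ws"
    "\<forall>x\<in>pverts T - ({u, v} \<union> set ws). \<forall>y\<in>{u, v} \<union> set ws. \<forall>z\<in>{u, v} \<union> set ws.
        (x, y) \<in> parcs T \<longleftrightarrow> (x, z) \<in> parcs T"
    using uv unfolding homog_arc_def Let_def by blast
  let ?C = "{u, v} \<union> set ws" and ?xs = "u # ws @ [v]"
  have sub: "?C \<subseteq> pverts T" using ws(1,2) sub by auto
  have sorted: "sorted_wrt (\<lambda>x y. (x, y) \<in> parcs T) ?xs"
    using ws by (auto simp: sorted_wrt_append)
  have C: "?C = set ?xs" by auto
  have "transitive_set (parcs T) ?C"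
    unfolding transitive_set_def
  proof (intro ballI impI notI)
    fix x y z assume "x \<in> ?C" "y \<in> ?C" "z \<in> ?C"
      and a: "(x, y) \<in> parcs T \<and> (y, z) \<in> parcs T" "(z, x) \<in> parcs T"
    then obtain i j k where ijk: "i < length ?xs" "x = ?xs ! i" "j < length ?xs" "y = ?xs ! j"
        "k < length ?xs" "z = ?xs ! k"
      unfolding C by (metis in_set_conv_nth)
    have lt: "p < q" if "p < length ?xs" "q < length ?xs" "(?xs ! p, ?xs ! q) \<in> parcs T" for p q
    proof (rule ccontr)
      assume "\<not> p < q"
      then consider "p = q" | "q < p" by linarith
      then show False
      proof cases
        case 1
        then show False
          using that sub C tournament_on_irrefl[OF T] by (metis nth_mem subsetD)
      next
        case 2
        then have r: "(?xs ! q, ?xs ! p) \<in> parcs T"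
          using sorted that by (auto simp only: sorted_wrt_iff_nth_less)
        have "?xs ! q \<in> pverts T" "?xs ! p \<in> pverts T"
          using that sub C by (metis nth_mem subsetD)+
        with r that show False
          using tournament_on_irrefl[OF T] tournament_on_swap[OF T] by metis
      qed
    qed
    show False
      using lt[of i j] lt[of j k] lt[of k i] ijk a by auto
  qed
  with ws(5) sub have "transitive_module (parcs T) (pverts T) ?C"
    unfolding transitive_module_def by blast
  then show ?thesis unfolding same_block_def by blast
qed

text \<open>Within the linearly ordered module \<open>C\<close>, the vertices between
  \<open>u\<close> and \<open>v\<close> form an interval. Vertices outside \<open>C\<close> do not
  distinguish its members, and the remaining vertices of \<open>C\<close> lie entirely before or
  entirely after it.\<close>

lemma same_block_homog_arc:
  assumes fin: "finite (pverts T)" and T: "tournament_on (parcs T) (pverts T)"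
    and C: "transitive_module (parcs T) (pverts T) C" "u \<in> C" "v \<in> C" "(u, v) \<in> parcs T"
  shows "homog_arc T u v"
proof -
  define W where "W = {w \<in> C. (u, w) \<in> parcs T \<and> (w, v) \<in> parcs T}"
  have W: "W \<subseteq> C" by (auto simp: W_def)
  note CS = transitive_moduleD(1)[OF C(1)]
  have "finite W" "tournament_on (parcs T) W" "transitive_set (parcs T) W"
    using W CS fin T transitive_moduleD(2)[OF C(1)]
    by (meson finite_subset tournament_on_subset transitive_set_subset subset_trans)+
  then obtain ws where ws: "set ws = W" "sorted_wrt (\<lambda>x y. (x, y) \<in> parcs T) ws"
    using transitive_list by metis
  have uniform: "(x, y) \<in> parcs T \<longleftrightarrow> (x, z) \<in> parcs T"
    if x: "x \<in> pverts T - ({u, v} \<union> W)" and yz: "y \<in> {u, v} \<union> W" "z \<in> {u, v} \<union> W" for x y z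
  proof -
    have yz': "y \<in> C" "z \<in> C" using yz C W by auto
    show ?thesis
    proof (cases "x \<in> C")
      case False
      then show ?thesis using transitive_moduleD(3)[OF C(1)] x yz' by blast
    next
      case True
      note tr = transitive_setD[OF T transitive_moduleD(2)[OF C(1)] CS]
      have sw: "\<And>y. y \<in> C \<Longrightarrow> y \<noteq> x \<Longrightarrow> (x, y) \<in> parcs T \<longleftrightarrow> (y, x) \<notin> parcs T"
        using tournament_on_swap[OF T] True CS by blast
      have ne: "y \<noteq> x" "z \<noteq> x" "u \<noteq> x" "v \<noteq> x" using x yz by auto
      \<comment> \<open>Since \<open>x\<close> is not between \<open>u\<close> and \<open>v\<close>,
        it comes after \<open>v\<close> or before \<open>u\<close>, and by transitivity on the same
        side of the whole interval.\<close>
      have "(x, v) \<notin> parcs T \<or> (u, x) \<notin> parcs T"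
        using True x by (auto simp: W_def)
      then consider "(v, x) \<in> parcs T" | "(x, u) \<in> parcs T"
        using sw C ne by blast
      then show ?thesis
      proof cases
        case 1
        have "(y, x) \<in> parcs T" if "y \<in> {u, v} \<union> W" for y
          using that 1 tr[of y v x] C(2-4) True W_def by blast
        then show ?thesis using sw yz yz' ne by blast
      next
        case 2
        have "(x, y) \<in> parcs T" if "y \<in> {u, v} \<union> W" for y
          using that 2 tr[of x u y] C(2-4) True W_def by blast
        then show ?thesis using yz by blast
      qed
    qed
  qed
  have "set ws \<subseteq> pverts T" using ws(1) W CS by blast
  moreover have "\<forall>w\<in>set ws. (u, w) \<in> parcs T \<and> (w, v) \<in> parcs T" using ws(1) W_def by blast
  moreover have "\<forall>x\<in>pverts T - ({u, v} \<union> set ws). \<forall>y\<in>{u, v} \<union> set ws. \<forall>z\<in>{u, v} \<union> set ws.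
      (x, y) \<in> parcs T \<longleftrightarrow> (x, z) \<in> parcs T"
    unfolding ws(1) using uniform by blast
  ultimately show ?thesis
    unfolding homog_arc_def Let_def using C(4) ws(2) by blast
qed

lemma homog_rel_eq_same_block:
  assumes "finite (pverts T)" "tournament_on (parcs T) (pverts T)" "parcs T \<subseteq> pverts T \<times> pverts T"
  shows "homog_rel T = same_block (parcs T) (pverts T)" (is "_ = ?B")
proof
  note eq = equiv_same_block[OF assms(2)]
  show "homog_rel T \<subseteq> ?B"
    using homog_arc_transitive_module[OF assms(2,3)] equivE[OF eq]
    unfolding homog_rel_def refl_on_def sym_def by blast
  show "?B \<subseteq> homog_rel T"
  proof
    fix p assume "p \<in> ?B"
    then obtain u v C where p: "p = (u, v)" "transitive_module (parcs T) (pverts T) C" "u \<in> C" "v \<in> C"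
      by (auto simp: same_block_def)
    then have "u \<in> pverts T" "v \<in> pverts T" using transitive_moduleD(1) by blast+
    then show "p \<in> homog_rel T"
      using p same_block_homog_arc[OF assms(1,2) p(2)] tournament_on_swap[OF assms(2), of u v]
      unfolding homog_rel_def by blast
  qed
qed

lemma homogeneous_blocks_eq:
  assumes "tournament T"
  shows "homogeneous_blocks T = pverts T // same_block (parcs T) (pverts T)"
  using homog_rel_eq_same_block[OF tournament_finite[OF assms] tournament_tournament_on[OF assms]
      tournament_arcs_subset[OF assms]]
  by (simp add: homogeneous_blocks_def)

section \<open>Induced sub-tournaments and isomorphic images\<close>

lemma transitive_module_Int:
  assumes "transitive_module A S C" "R \<subseteq> S"
  shows "transitive_module A R (C \<inter> R)"
  unfolding transitive_module_def
proof (intro conjI ballI)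
  show "transitive_set A (C \<inter> R)"
    using transitive_set_subset[OF transitive_moduleD(2)[OF assms(1)]] by blast
  show "(x, y) \<in> A \<longleftrightarrow> (x, z) \<in> A" if "x \<in> R - C \<inter> R" "y \<in> C \<inter> R" "z \<in> C \<inter> R" for x y z
    using transitive_moduleD(3)[OF assms(1), of x y z] that assms(2) by blast
qed blast

lemma same_block_trans:
  assumes "tournament_on A S" "(x, y) \<in> same_block A S" "(y, z) \<in> same_block A S"
  shows "(x, z) \<in> same_block A S"
  using equivE[OF equiv_same_block[OF assms(1)]] assms(2,3) by (meson transD)

lemma same_block_refl: "tournament_on A S \<Longrightarrow> x \<in> S \<Longrightarrow> (x, x) \<in> same_block A S"
  using transitive_module_singleton unfolding same_block_def by fastforce

lemma same_block_subset: "(x, y) \<in> same_block A S \<Longrightarrow> x \<in> S \<and> y \<in> S"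
  unfolding same_block_def transitive_module_def by blast

lemma same_blockE:
  assumes "(x, y) \<in> same_block A S"
  obtains C where "transitive_module A S C" "x \<in> C" "y \<in> C"
  using assms unfolding same_block_def by blast

lemma same_blockI:
  assumes "transitive_module A S C" "x \<in> C" "y \<in> C"
  shows "(x, y) \<in> same_block A S"
  using assms unfolding same_block_def by blast

text \<open>First \<open>s\<close> is moved to \<open>s'\<close> inside a module that avoids
  \<open>t\<close>, then \<open>t\<close> to \<open>t'\<close> inside a module that avoids
  \<open>s'\<close>. This makes the quotient tournament on the blocks well defined.\<close>

lemma same_block_arc_cong:
  assumes T: "tournament_on A S"
    and s: "(s, s') \<in> same_block A S" and t: "(t, t') \<in> same_block A S"
    and st: "(s, t) \<notin> same_block A S"
  shows "(s, t) \<in> A \<longleftrightarrow> (s', t') \<in> A"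
proof -
  obtain C where C: "transitive_module A S C" "s \<in> C" "s' \<in> C" using s by (rule same_blockE)
  obtain D where D: "transitive_module A S D" "t \<in> D" "t' \<in> D" using t by (rule same_blockE)
  have in_S: "s' \<in> S" "t \<in> S" using same_block_subset[OF s] same_block_subset[OF t] by blast+
  have "t \<notin> C" using same_blockI[OF C(1,2)] st by blast
  then have "(s, t) \<in> A \<longleftrightarrow> (s', t) \<in> A"
    using transitive_module_swap[OF T C(1) in_S(2)] C by blast
  moreover have "s' \<notin> D"
    using same_blockI[OF D(1) _ D(2)] same_block_trans[OF T s] st by blast
  then have "(s', t) \<in> A \<longleftrightarrow> (s', t') \<in> A"
    using transitive_moduleD(3)[OF D(1) in_S(1)] D by blast
  ultimately show ?thesis by blast
qed

text \<open>The third vertex of such a triangle would either violate transitivity inside the module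
  or distinguish \<open>x\<close> from \<open>y\<close> from outside. Thus the vertices of a cyclic
  triangle lie in three different blocks.\<close>

lemma same_block_no_cycle:
  assumes T: "tournament_on A S" and xy: "(x, y) \<in> same_block A S" and z: "z \<in> S"
    and arcs: "(x, y) \<in> A" "(y, z) \<in> A"
  shows "(z, x) \<notin> A"
proof
  assume zx: "(z, x) \<in> A"
  obtain C where C: "transitive_module A S C" "x \<in> C" "y \<in> C" using xy by (rule same_blockE)
  have y: "y \<in> S" using same_block_subset[OF xy] by blast
  show False
  proof (cases "z \<in> C")
    case True
    show False
      using transitive_set_no_cycle[OF transitive_moduleD(2)[OF C(1)] C(2,3) True arcs] zx by blast
  next
    case False
    then have "(z, y) \<in> A"
      using transitive_moduleD(3)[OF C(1) z False C(2,3)] zx by blast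
    then show False
      using arcs(2) tournament_on_irrefl[OF T y] tournament_on_swap[OF T y z] by metis
  qed
qed

text \<open>Modules restrict to \<open>R\<close>, which gives one inclusion. For the other, a
  transitive module \<open>D\<close> of \<open>R\<close> is blown up to the union \<open>D'\<close>
  of the blocks of \<open>S\<close> that meet it. Every vertex has a representative in
  \<open>R\<close> with the same arcs to other blocks, so a vertex distinguishing members of
  \<open>D'\<close>, or a cyclic triangle in \<open>D'\<close>, projects to one for
  \<open>D\<close>. Deleting vertices can merge blocks in general; this says that it does not as
  long as every block is met.\<close>

lemma same_block_subtournament:
  assumes T: "tournament_on A S" and R: "R \<subseteq> S"
    and cover: "\<And>x. x \<in> S \<Longrightarrow> \<exists>r\<in>R. (x, r) \<in> same_block A S"
  shows "same_block A R = same_block A S \<inter> R \<times> R"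
proof
  show "same_block A S \<inter> R \<times> R \<subseteq> same_block A R"
  proof
    fix p assume "p \<in> same_block A S \<inter> R \<times> R"
    moreover obtain x y where p: "p = (x, y)" by (cases p)
    ultimately have xy: "(x, y) \<in> same_block A S" "x \<in> R" "y \<in> R" by simp_all
    obtain C where C: "transitive_module A S C" "x \<in> C" "y \<in> C"
      using xy(1) by (rule same_blockE)
    then have "x \<in> C \<inter> R" "y \<in> C \<inter> R" using xy by blast+
    then show "p \<in> same_block A R"
      unfolding p by (rule same_blockI[OF transitive_module_Int[OF C(1) R]])
  qed
  show "same_block A R \<subseteq> same_block A S \<inter> R \<times> R"
  proof
    fix p assume "p \<in> same_block A R"
    moreover obtain x y where p: "p = (x, y)" by (cases p)
    ultimately obtain D where D: "transitive_module A R D" "x \<in> D" "y \<in> D"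
      by (metis same_blockE)
    have DR: "D \<subseteq> R" using transitive_moduleD(1)[OF D(1)] .
    define D' where "D' = {s. \<exists>d\<in>D. (s, d) \<in> same_block A S}"
    have D'S: "D' \<subseteq> S" unfolding D'_def by (auto dest: same_block_subset)
    have DD': "D \<subseteq> D'"
    proof
      fix d assume d: "d \<in> D"
      then have "(d, d) \<in> same_block A S" using DR R by (intro same_block_refl[OF T]) blast
      then show "d \<in> D'" unfolding D'_def using d by blast
    qed
    have "transitive_module A S D'"
      unfolding transitive_module_def
    proof (intro conjI ballI)
      show "D' \<subseteq> S" by fact
      fix w y z assume w: "w \<in> S - D'" and y: "y \<in> D'" and z: "z \<in> D'"
      obtain r where r: "r \<in> R" "(w, r) \<in> same_block A S" using cover w by blast
      have rD: "r \<notin> D" using r w unfolding D'_def by blast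
      obtain d where d: "d \<in> D" "(y, d) \<in> same_block A S" using y unfolding D'_def by blast
      obtain e where e: "e \<in> D" "(z, e) \<in> same_block A S" using z unfolding D'_def by blast
      have out: "(w, y) \<notin> same_block A S" if "d \<in> D" "(y, d) \<in> same_block A S" for y d
        using w same_block_trans[OF T _ that(2)] that(1) unfolding D'_def by blast
      have "(w, y) \<in> A \<longleftrightarrow> (r, d) \<in> A"
        using same_block_arc_cong[OF T r(2) d(2) out[OF d]] .
      also have "\<dots> \<longleftrightarrow> (r, e) \<in> A"
        using transitive_moduleD(3)[OF D(1) r(1) rD d(1) e(1)] .
      also have "\<dots> \<longleftrightarrow> (w, z) \<in> A"
        using same_block_arc_cong[OF T r(2) e(2) out[OF e]] by blast
      finally show "(w, y) \<in> A \<longleftrightarrow> (w, z) \<in> A" .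
    next
      show "transitive_set A D'"
        unfolding transitive_set_def
      proof (intro ballI impI notI)
        fix x y z assume xyz: "x \<in> D'" "y \<in> D'" "z \<in> D'" and a: "(x, y) \<in> A \<and> (y, z) \<in> A" "(z, x) \<in> A"
        have inS: "x \<in> S" "y \<in> S" "z \<in> S" using xyz D'S by blast+
        have ne: "(x, y) \<notin> same_block A S" "(y, z) \<notin> same_block A S" "(z, x) \<notin> same_block A S"
          using same_block_no_cycle[OF T _ inS(3), of x y] same_block_no_cycle[OF T _ inS(1), of y z]
            same_block_no_cycle[OF T _ inS(2), of z x] a by metis+
        obtain d e f where def: "d \<in> D" "(x, d) \<in> same_block A S" "e \<in> D" "(y, e) \<in> same_block A S"
            "f \<in> D" "(z, f) \<in> same_block A S"
          using xyz unfolding D'_def by blast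
        have "(d, e) \<in> A" "(e, f) \<in> A" "(f, d) \<in> A"
          using same_block_arc_cong[OF T def(2,4) ne(1)] same_block_arc_cong[OF T def(4,6) ne(2)]
            same_block_arc_cong[OF T def(6,2) ne(3)] a by metis+
        then show False
          using transitive_set_no_cycle[OF transitive_moduleD(2)[OF D(1)] def(1,3,5)] by blast
      qed
    qed
    then have "(x, y) \<in> same_block A S"
      by (rule same_blockI) (use D DD' in blast)+
    then show "p \<in> same_block A S \<inter> R \<times> R"
      using D DR p by blast
  qed
qed

section \<open>Invariance of blocks and their sizes under isomorphism\<close>

lemma transitive_module_image:
  assumes f: "bij_betw f S S'" and arcs: "\<And>x y. x \<in> S \<Longrightarrow> y \<in> S \<Longrightarrow> (f x, f y) \<in> A' \<longleftrightarrow> (x, y) \<in> A"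
    and C: "transitive_module A S C"
  shows "transitive_module A' S' (f ` C)"
proof -
  note CS = transitive_moduleD(1)[OF C]
  have im: "f ` S = S'" using f by (simp add: bij_betw_def)
  show ?thesis
    unfolding transitive_module_def
  proof (intro conjI ballI)
    show "f ` C \<subseteq> S'" using CS im by blast
    show "transitive_set A' (f ` C)"
      unfolding transitive_set_def
    proof (intro ballI impI)
      fix x y z assume "x \<in> f ` C" "y \<in> f ` C" "z \<in> f ` C" and a: "(x, y) \<in> A' \<and> (y, z) \<in> A'"
      then obtain u v w where uvw: "u \<in> C" "v \<in> C" "w \<in> C" "x = f u" "y = f v" "z = f w" by blast
      then have inS: "u \<in> S" "v \<in> S" "w \<in> S" using CS by blast+
      show "(z, x) \<notin> A'"
        using transitive_set_no_cycle[OF transitive_moduleD(2)[OF C] uvw(1-3)] a arcs inS uvw(4-6)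
        by simp
    qed
    fix x y z assume x: "x \<in> S' - f ` C" and y: "y \<in> f ` C" and z: "z \<in> f ` C"
    obtain u where u: "u \<in> S" "u \<notin> C" "x = f u" using x im by blast
    obtain v where v: "v \<in> C" "y = f v" using y by blast
    obtain w where w: "w \<in> C" "z = f w" using z by blast
    show "(x, y) \<in> A' \<longleftrightarrow> (x, z) \<in> A'"
      using transitive_moduleD(3)[OF C u(1,2) v(1) w(1)] arcs[OF u(1), of v] arcs[OF u(1), of w]
        u v w CS by blast
  qed
qed

lemma same_block_image:
  assumes f: "bij_betw f S S'" and arcs: "\<And>x y. x \<in> S \<Longrightarrow> y \<in> S \<Longrightarrow> (f x, f y) \<in> A' \<longleftrightarrow> (x, y) \<in> A"
    and "(x, y) \<in> same_block A S"
  shows "(f x, f y) \<in> same_block A' S'"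
  using assms(3) by (rule same_blockE) (blast intro: same_blockI transitive_module_image[OF f arcs])

lemma blocks_image:
  assumes f: "bij_betw f S S'" and arcs: "\<And>x y. x \<in> S \<Longrightarrow> y \<in> S \<Longrightarrow> (f x, f y) \<in> A' \<longleftrightarrow> (x, y) \<in> A"
    and B: "B \<in> S // same_block A S"
  shows "f ` B \<in> S' // same_block A' S'" "card (f ` B) = card B"
proof -
  obtain x where x: "x \<in> S" "B = same_block A S `` {x}" using B by (rule quotientE)
  have BS: "B \<subseteq> S" using x same_block_subset by fastforce
  let ?g = "inv_into S f"
  have g: "bij_betw ?g S' S" using f by (rule bij_betw_inv_into)
  have gf: "\<And>x. x \<in> S \<Longrightarrow> ?g (f x) = x" and fg: "\<And>x. x \<in> S' \<Longrightarrow> f (?g x) = x"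
    using f by (simp_all add: bij_betw_inv_into_left bij_betw_inv_into_right)
  have gS: "\<And>x. x \<in> S' \<Longrightarrow> ?g x \<in> S" using g by (auto simp: bij_betw_def)
  have garcs: "(?g x, ?g y) \<in> A \<longleftrightarrow> (x, y) \<in> A'" if "x \<in> S'" "y \<in> S'" for x y
    using arcs[of "?g x" "?g y"] that gS fg by simp
  have "f ` B = same_block A' S' `` {f x}"
  proof
    show "f ` B \<subseteq> same_block A' S' `` {f x}"
      using same_block_image[OF f arcs] x by blast
    show "same_block A' S' `` {f x} \<subseteq> f ` B"
    proof
      fix y assume "y \<in> same_block A' S' `` {f x}"
      then have y: "(f x, y) \<in> same_block A' S'" by blast
      then have "(?g (f x), ?g y) \<in> same_block A S"
        by (rule same_block_image[OF g, rotated]) (rule garcs)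
      then have "?g y \<in> B" using x gf by simp
      then show "y \<in> f ` B" using same_block_subset[OF y] fg by (metis imageI)
    qed
  qed
  moreover have "f x \<in> S'" using x(1) f by (auto simp: bij_betw_def)
  ultimately show "f ` B \<in> S' // same_block A' S'" by (simp add: quotientI)
  show "card (f ` B) = card B"
    using BS f by (meson bij_betw_def card_image inj_on_subset)
qed

text \<open>The set of block sizes, without multiplicities, is the isomorphism invariant by which
  the lower bound tells tournaments apart.\<close>

lemma block_cards_image:
  assumes f: "bij_betw f S S'" and arcs: "\<And>x y. x \<in> S \<Longrightarrow> y \<in> S \<Longrightarrow> (f x, f y) \<in> A' \<longleftrightarrow> (x, y) \<in> A"
  shows "card ` (S // same_block A S) = card ` (S' // same_block A' S')"
proof -
  have sub: "card ` (S // same_block A S) \<subseteq> card ` (S' // same_block A' S')"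
    if f: "bij_betw f S S'" and arcs: "\<And>x y. x \<in> S \<Longrightarrow> y \<in> S \<Longrightarrow> (f x, f y) \<in> A' \<longleftrightarrow> (x, y) \<in> A"
    for f S S' A A'
    using blocks_image[OF f arcs] by (metis image_eqI image_subsetI)
  let ?g = "inv_into S f"
  have g: "bij_betw ?g S' S" using f by (rule bij_betw_inv_into)
  have "(?g x, ?g y) \<in> A \<longleftrightarrow> (x, y) \<in> A'" if "x \<in> S'" "y \<in> S'" for x y
    using arcs[of "?g x" "?g y"] that bij_betwE[OF g] f by (simp add: bij_betw_inv_into_right)
  then have "card ` (S' // same_block A' S') \<subseteq> card ` (S // same_block A S)"
    by (rule sub[OF g])
  moreover have "card ` (S // same_block A S) \<subseteq> card ` (S' // same_block A' S')"
    using arcs by (rule sub[OF f])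
  ultimately show ?thesis by blast
qed

section \<open>From sorted block sizes to numbers of large blocks\<close>

lemma nth_ge_iff_less_length_filter:
  fixes xs :: "'a::linorder list"
  assumes "sorted_wrt (\<ge>) xs"
  shows "l < length xs \<and> m \<le> xs ! l \<longleftrightarrow> l < length (filter (\<lambda>x. m \<le> x) xs)"
  using assms
proof (induction xs arbitrary: l)
  case Nil
  then show ?case by simp
next
  case (Cons x xs)
  show ?case
  proof (cases "m \<le> x")
    case True
    then show ?thesis using Cons by (cases l) auto
  next
    case False
    then have "\<forall>y\<in>set xs. \<not> m \<le> y" using Cons.prems by fastforce
    then have "filter (\<lambda>x. m \<le> x) (x # xs) = []" "l < length (x # xs) \<Longrightarrow> \<not> m \<le> (x # xs) ! l"
      using False by (auto simp: nth_Cons split: nat.split)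
    then show ?thesis by auto
  qed
qed

text \<open>In a non-increasing list the entries that are at least \<open>m\<close> form an initial
  segment. Later arguments can therefore count large blocks instead of indexing the sorted
  list.\<close>

lemma block_sizes_nth_ge_iff:
  assumes "finite (homogeneous_blocks T)"
  shows "l < length (block_sizes T) \<and> m \<le> block_sizes T ! l \<longleftrightarrow>
           l < card {B \<in> homogeneous_blocks T. m \<le> card B}"
proof -
  let ?M = "image_mset card (mset_set (homogeneous_blocks T))"
  have "sorted_wrt (\<ge>) (block_sizes T)"
    unfolding block_sizes_def sorted_wrt_rev by simp
  moreover have "length (filter (\<lambda>x. m \<le> x) (block_sizes T)) = size (filter_mset (\<lambda>x. m \<le> x) ?M)"
    unfolding block_sizes_def by (simp flip: size_mset add: mset_filter)
  moreover have "\<dots> = card {B \<in> homogeneous_blocks T. m \<le> card B}"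
    using assms by (simp add: filter_mset_image_mset Collect_conj_eq)
  ultimately show ?thesis
    using nth_ge_iff_less_length_filter by metis
qed

section \<open>Sub-tournaments of members of a hereditary property\<close>

definition subtournament :: "'a pair_pre_digraph \<Rightarrow> 'a set \<Rightarrow> 'a pair_pre_digraph" where
  "subtournament T S = \<lparr>pverts = S, parcs = parcs T \<inter> S \<times> S\<rparr>"

lemma subtournament_simps [simp]:
  "pverts (subtournament T S) = S" "parcs (subtournament T S) = parcs T \<inter> S \<times> S"
  by (simp_all add: subtournament_def)

lemma tournament_subtournament:
  assumes "tournament T" "S \<subseteq> pverts T"
  shows "tournament (subtournament T S)"
proof -
  interpret tournament T by fact
  show ?thesis
  proof
    show "finite (pverts (subtournament T S))"
      using assms(2) pair_finite_verts by (simp add: finite_subset)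
    show "(u, v) \<in> parcs (subtournament T S) \<longleftrightarrow> (v, u) \<notin> parcs (subtournament T S)"
      if "u \<in> pverts (subtournament T S)" "v \<in> pverts (subtournament T S)" "u \<noteq> v" for u v
      using that tournament_arcs[of u v] assms(2) by auto
    show "fst e \<noteq> snd e" if "e \<in> parcs (subtournament T S)" for e
      using that pair_no_loops by simp
    show "finite (parcs (subtournament T S))"
      using pair_finite_arcs by simp
  qed auto
qed

lemma same_block_cong:
  assumes "\<And>x y. x \<in> S \<Longrightarrow> y \<in> S \<Longrightarrow> (x, y) \<in> A' \<longleftrightarrow> (x, y) \<in> A"
  shows "same_block A' S = same_block A S"
proof -
  have "same_block A S \<subseteq> same_block A' S"
    if "\<And>x y. x \<in> S \<Longrightarrow> y \<in> S \<Longrightarrow> (x, y) \<in> A' \<longleftrightarrow> (x, y) \<in> A" for A A'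
    using same_block_image[of id S S A' A] that by auto
  from this[of A' A] this[of A A'] assms show ?thesis by auto
qed

lemma homogeneous_blocks_subtournament:
  assumes "tournament T" "S \<subseteq> pverts T"
  shows "homogeneous_blocks (subtournament T S) = S // same_block (parcs T) S"
proof -
  have "same_block (parcs T \<inter> S \<times> S) S = same_block (parcs T) S"
    by (rule same_block_cong) blast
  then show ?thesis
    using homogeneous_blocks_eq[OF tournament_subtournament[OF assms]] by simp
qed

lemma hereditary_subtournament:
  assumes P: "hereditary_property P" and T: "T \<in> P" and S: "S \<subseteq> pverts T" "S \<noteq> {}"
  shows "subtournament T S \<in> P"
proof -
  have "tournament T" using P T unfolding hereditary_property_def by blast
  then interpret tournament T .
  interpret H: tournament "subtournament T S"
    using tournament_subtournament[OF \<open>tournament T\<close> S(1)] .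
  have "induced_subgraph (with_proj (subtournament T S)) (with_proj T)"
    using S wf_digraph_axioms H.wf_digraph_axioms
    unfolding induced_subgraph_def subgraph_def by auto
  moreover have "pverts (subtournament T S) \<noteq> {}" using S(2) by simp
  ultimately show ?thesis
    using P T unfolding hereditary_property_def by blast
qed

lemma finite_homogeneous_blocks:
  assumes "tournament T"
  shows "finite (homogeneous_blocks T)"
  using homogeneous_blocks_eq[OF assms] equiv_same_block[OF tournament_tournament_on[OF assms]]
    tournament_finite[OF assms]
  by (simp add: finite_quotient equiv_type)

section \<open>Many blocks force many large blocks\<close>

lemma transitive_set_insert:
  assumes "transitive_set A V" "(x, x) \<notin> A" "(\<forall>v\<in>V. (v, x) \<notin> A) \<or> (\<forall>v\<in>V. (x, v) \<notin> A)"
  shows "transitive_set A (insert x V)"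
  using assms unfolding transitive_set_def by (metis insertE)

text \<open>The Erdos-Moser halving argument: of the at least \<open>2 * 2 ^ n - 1\<close> vertices
  other than \<open>x\<close>, at least \<open>2 ^ n\<close> are all out-neighbours or all
  in-neighbours of \<open>x\<close>, and \<open>x\<close> extends any transitive set found among
  them.\<close>

lemma transitive_subset_exists:
  assumes "finite R" "tournament_on A R" "2 ^ n \<le> card R"
  shows "\<exists>V\<subseteq>R. transitive_set A V \<and> n \<le> card V"
  using assms
proof (induction n arbitrary: R)
  case 0
  have "transitive_set A {}" by (simp add: transitive_set_def)
  then show ?case by blast
next
  case (Suc n)
  have "R \<noteq> {}" using Suc.prems(3) by auto
  then obtain x where x: "x \<in> R" by blast
  define Out where "Out = {y \<in> R. (x, y) \<in> A}"
  define In where "In = R - {x} - Out"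
  have xx: "(x, x) \<notin> A" using tournament_on_irrefl[OF Suc.prems(2) x] .
  have "card (Out \<union> In) = card Out + card In"
    using Suc.prems(1) unfolding Out_def In_def by (intro card_Un_disjoint) (simp, simp, blast)
  moreover have "Out \<union> In = R - {x}" unfolding Out_def In_def using xx by blast
  moreover have "2 ^ Suc n - 1 \<le> card (R - {x})" using Suc.prems(1,3) x by simp
  ultimately have "2 * 2 ^ n - 1 \<le> card Out + card In" by simp
  then have "2 ^ n \<le> card Out \<or> 2 ^ n \<le> card In" by linarith
  then show ?case
  proof
    assume c: "2 ^ n \<le> card Out"
    have "Out \<subseteq> R" by (auto simp: Out_def)
    then obtain V where V: "V \<subseteq> Out" "transitive_set A V" "n \<le> card V"
      using Suc.IH[OF _ _ c] Suc.prems(1,2) tournament_on_subset finite_subset by metis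
    have xV: "x \<notin> V" using V(1) xx by (auto simp: Out_def)
    have "(v, x) \<notin> A" if "v \<in> V" for v
      using that V(1) xV x tournament_on_swap[OF Suc.prems(2), of x v] by (auto simp: Out_def)
    then have "transitive_set A (insert x V)" using transitive_set_insert[OF V(2) xx] by blast
    moreover have "finite V" using V(1) Suc.prems(1) by (auto simp: Out_def intro: finite_subset)
    ultimately show ?thesis
      using V x xV \<open>Out \<subseteq> R\<close> by (intro exI[of _ "insert x V"]) auto
  next
    assume c: "2 ^ n \<le> card In"
    have "In \<subseteq> R" by (auto simp: In_def)
    then obtain V where V: "V \<subseteq> In" "transitive_set A V" "n \<le> card V"
      using Suc.IH[OF _ _ c] Suc.prems(1,2) tournament_on_subset finite_subset by metis
    have xV: "x \<notin> V" using V(1) by (auto simp: In_def)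
    have "(x, v) \<notin> A" if "v \<in> V" for v
      using that V(1) by (auto simp: In_def Out_def)
    then have "transitive_set A (insert x V)" using transitive_set_insert[OF V(2) xx] by blast
    moreover have "finite V" using V(1) Suc.prems(1) by (auto simp: In_def intro: finite_subset)
    ultimately show ?thesis
      using V x xV \<open>In \<subseteq> R\<close> by (intro exI[of _ "insert x V"]) auto
  qed
qed

text \<open>One vertex is chosen from each block. The choice meets every block, so by
  \<open>same_block_subtournament\<close> the blocks it induces are singletons.\<close>

lemma block_representatives:
  assumes T: "tournament_on A S"
  obtains R where "R \<subseteq> S" "card R = card (S // same_block A S)" "same_block A R \<subseteq> Id"
proof -
  note eq = equiv_same_block[OF T]
  define r where "r = (\<lambda>B :: 'a set. SOME x. x \<in> B)"
  have r: "r B \<in> B" if "B \<in> S // same_block A S" for B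
    using in_quotient_imp_non_empty[OF eq that] unfolding r_def by (simp add: some_in_eq)
  let ?R = "r ` (S // same_block A S)"
  have RS: "?R \<subseteq> S"
    using r in_quotient_imp_subset[OF eq] by blast
  have r_eq: "B = C" if "B \<in> S // same_block A S" "C \<in> S // same_block A S"
    "(r B, r C) \<in> same_block A S" for B C
    using quotient_eq_iff[OF eq that(1,2) r[OF that(1)] r[OF that(2)]] that(3) by simp
  have "inj_on r (S // same_block A S)"
  proof (rule inj_onI)
    fix B C assume B: "B \<in> S // same_block A S" and C: "C \<in> S // same_block A S" and "r B = r C"
    moreover have "r B \<in> S" using B RS by blast
    ultimately show "B = C" using r_eq[OF B C] same_block_refl[OF T] by simp
  qed
  then have "card ?R = card (S // same_block A S)" by (rule card_image)
  moreover have "\<exists>y\<in>?R. (x, y) \<in> same_block A S" if x: "x \<in> S" for x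
  proof -
    have B: "same_block A S `` {x} \<in> S // same_block A S" using x by (rule quotientI)
    then have "(x, r (same_block A S `` {x})) \<in> same_block A S" using r by blast
    then show ?thesis using B by blast
  qed
  then have E: "same_block A ?R = same_block A S \<inter> ?R \<times> ?R"
    by (rule same_block_subtournament[OF T RS])
  have "same_block A ?R \<subseteq> Id"
  proof
    fix p assume "p \<in> same_block A ?R"
    then obtain B C where BC: "B \<in> S // same_block A S" "C \<in> S // same_block A S"
        "p = (r B, r C)" "(r B, r C) \<in> same_block A S"
      unfolding E by blast
    then show "p \<in> Id" using r_eq[OF BC(1,2,4)] by simp
  qed
  ultimately show ?thesis using that RS by blast
qed

text \<open>
  The vertex \<open>z\<close> distinguishes \<open>a\<close> from \<open>b\<close>, hence belongs to every module containing both. In the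
  first case \<open>a, b, z\<close> is a cyclic triangle and \<open>u\<close> is irrelevant; in the other two, \<open>u\<close> forms a
  cyclic triangle with \<open>z\<close> and one of \<open>a, b\<close>.
\<close>

definition separator :: "'a rel \<Rightarrow> 'a \<Rightarrow> 'a \<Rightarrow> 'a \<Rightarrow> 'a \<Rightarrow> bool" where
  "separator A a b z u \<longleftrightarrow> (a, b) \<in> A \<and> z \<noteq> a \<and> z \<noteq> b \<and>
     ((b, z) \<in> A \<and> (z, a) \<in> A \<or>
      (a, z) \<in> A \<and> (z, b) \<in> A \<and> ((z, u) \<in> A \<and> (u, a) \<in> A \<or> (b, u) \<in> A \<and> (u, z) \<in> A))"

text \<open>The surrounding set \<open>S\<close> enters only through \<open>z\<close> and
  \<open>u\<close>, so the separation persists in every sub-tournament that keeps these two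
  vertices. This is what allows most other vertices to be deleted later.\<close>

lemma separator_not_same_block:
  assumes T: "tournament_on A S" and zu: "z \<in> S" "u \<in> S" and sep: "separator A a b z u"
  shows "(a, b) \<notin> same_block A S"
proof
  assume E: "(a, b) \<in> same_block A S"
  then obtain C where C: "transitive_module A S C" "a \<in> C" "b \<in> C" by (rule same_blockE)
  have ab: "a \<in> S" "b \<in> S" using same_block_subset[OF E] by blast+
  have ne: "(a, b) \<in> A" "z \<noteq> a" using sep by (simp_all add: separator_def)
  from sep consider "(b, z) \<in> A" "(z, a) \<in> A"
    | "(a, z) \<in> A" "(z, b) \<in> A" "(z, u) \<in> A" "(u, a) \<in> A"
    | "(a, z) \<in> A" "(z, b) \<in> A" "(b, u) \<in> A" "(u, z) \<in> A"
    unfolding separator_def by argo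
  then show False
  proof cases
    case 1
    then show False using same_block_no_cycle[OF T E zu(1) ne(1)] by argo
  next
    case 2
    have "(z, a) \<notin> A" using tournament_on_swap[OF T zu(1) ab(1) ne(2)] 2(1) by argo
    then have "z \<in> C" using transitive_moduleD(3)[OF C(1) zu(1) _ C(2,3)] 2(2) by argo
    then show False
      using same_block_no_cycle[OF T same_blockI[OF C(1,2)] zu(2) 2(1,3)] 2(4) by argo
  next
    case 3
    have "(z, a) \<notin> A" using tournament_on_swap[OF T zu(1) ab(1) ne(2)] 3(1) by argo
    then have "z \<in> C" using transitive_moduleD(3)[OF C(1) zu(1) _ C(2,3)] 3(2) by argo
    then show False
      using same_block_no_cycle[OF T same_blockI[OF C(1) _ C(3)] zu(2) 3(2,3)] 3(4) by argo
  qed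
qed

lemma sorted_arc_iff:
  assumes T: "tournament_on A R" and vs: "set vs \<subseteq> R" "sorted_wrt (\<lambda>x y. (x, y) \<in> A) vs"
    and ij: "i < length vs" "j < length vs"
  shows "(vs ! i, vs ! j) \<in> A \<longleftrightarrow> i < j"
proof -
  have lt: "(vs ! i, vs ! j) \<in> A" if "i < j" "j < length vs" for i j
    using vs(2) that by (auto simp: sorted_wrt_iff_nth_less)
  have R: "vs ! i \<in> R" "vs ! j \<in> R" using vs(1) ij by auto
  consider "i < j" | "i = j" | "j < i" by linarith
  then show ?thesis
  proof cases
    case 3
    then show ?thesis
      using lt[OF 3 ij(1)] tournament_on_irrefl[OF T R(1)] tournament_on_swap[OF T R]
      by (metis less_asym)
  qed (use lt ij tournament_on_irrefl[OF T R(1)] in auto)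
qed

text \<open>If no vertex distinguished \<open>a\<close> from \<open>b\<close>, the set
  \<open>{a, b}\<close> would be a transitive module. A distinguishing vertex lies between the two
  or closes a cyclic triangle with them.\<close>

lemma not_same_block_distinguished:
  assumes T: "tournament_on A R" and ab: "a \<in> R" "b \<in> R" "(a, b) \<in> A"
    and E: "(a, b) \<notin> same_block A R"
  obtains z where "z \<in> R" "z \<noteq> a" "z \<noteq> b"
    "(a, z) \<in> A \<and> (z, b) \<in> A \<or> (b, z) \<in> A \<and> (z, a) \<in> A"
proof -
  have irrefl: "(a, a) \<notin> A" "(b, b) \<notin> A" using tournament_on_irrefl[OF T] ab by blast+
  have "transitive_set A {a, b}"
    using irrefl unfolding transitive_set_def by blast
  moreover have "\<not> transitive_module A R {a, b}"
    using E same_blockI[of A R "{a, b}" a b] by blast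
  ultimately obtain z where z: "z \<in> R" "z \<noteq> a" "z \<noteq> b" "((z, a) \<in> A) \<noteq> ((z, b) \<in> A)"
    using ab unfolding transitive_module_def by auto
  then have "(a, z) \<in> A \<and> (z, b) \<in> A \<or> (b, z) \<in> A \<and> (z, a) \<in> A"
    using tournament_on_swap[OF T z(1) ab(1)] tournament_on_swap[OF T z(1) ab(2)] by argo
  with z that show ?thesis by blast
qed

text \<open>
  If \<open>z\<close> lies between two consecutive vertices of a longest chain, then it cannot be inserted
  into the chain, so it forms a cyclic triangle with one of them and a further chain vertex.
\<close>

lemma separator_exists:
  assumes T: "tournament_on A R" and fin: "finite R"
    and vs: "set vs \<subseteq> R" "distinct vs" "sorted_wrt (\<lambda>x y. (x, y) \<in> A) vs"
    and max: "\<And>V. V \<subseteq> R \<Longrightarrow> transitive_set A V \<Longrightarrow> card V \<le> length vs"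
    and tr: "transitive_set A (set vs)"
    and i: "Suc i < length vs" and E: "(vs ! i, vs ! Suc i) \<notin> same_block A R"
  shows "\<exists>z\<in>R. \<exists>u\<in>R. separator A (vs ! i) (vs ! Suc i) z u"
proof -
  let ?a = "vs ! i" and ?b = "vs ! Suc i"
  note arc = sorted_arc_iff[OF T vs(1,3)]
  have ab: "?a \<in> R" "?b \<in> R" "(?a, ?b) \<in> A" using vs(1) i arc[of i "Suc i"] by auto
  obtain z where z: "z \<in> R" "z \<noteq> ?a" "z \<noteq> ?b"
    and cases: "(?a, z) \<in> A \<and> (z, ?b) \<in> A \<or> (?b, z) \<in> A \<and> (z, ?a) \<in> A"
    using not_same_block_distinguished[OF T ab E] by blast
  show ?thesis
  proof (cases "(?b, z) \<in> A \<and> (z, ?a) \<in> A")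
    case True
    \<comment> \<open>The triangle on \<open>a, b, z\<close> already separates, so \<open>z\<close>
      fills the place of \<open>u\<close>.\<close>
    then have "separator A ?a ?b z z" using z ab by (simp add: separator_def)
    then show ?thesis using z by blast
  next
    case False
    then have az: "(?a, z) \<in> A" and zb: "(z, ?b) \<in> A" using cases by argo+
    have za: "(z, ?a) \<notin> A" using tournament_on_swap[OF T z(1) ab(1) z(2)] az by argo
    have zV: "z \<notin> set vs"
    proof
      assume "z \<in> set vs"
      then obtain k where k: "k < length vs" "z = vs ! k" by (auto simp: in_set_conv_nth)
      have "i < k" "k < Suc i" using arc[of i k] arc[of k "Suc i"] az zb i k by auto
      then show False by simp
    qed
    have "card (insert z (set vs)) = Suc (length vs)"
      using zV vs(2) by (simp add: distinct_card)
    then have "\<not> transitive_set A (insert z (set vs))"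
      using max[of "insert z (set vs)"] vs(1) z(1) by auto
    then obtain x y w where xyw: "x \<in> insert z (set vs)" "y \<in> insert z (set vs)" "w \<in> insert z (set vs)"
        "(x, y) \<in> A" "(y, w) \<in> A" "(w, x) \<in> A"
      unfolding transitive_set_def by blast
    have zz: "(z, z) \<notin> A" using tournament_on_irrefl[OF T z(1)] .
    have "\<not> (x \<in> set vs \<and> y \<in> set vs \<and> w \<in> set vs)"
      using transitive_set_no_cycle[OF tr, of x y w] xyw(4-6) by argo
    \<comment> \<open>The triangle passes through \<open>z\<close>, and only once as there are no
      loops; it is rotated so that \<open>z\<close> comes last.\<close>
    then have "\<exists>p\<in>set vs. \<exists>q\<in>set vs. (p, q) \<in> A \<and> (q, z) \<in> A \<and> (z, p) \<in> A"
      using xyw zz by (metis insertE)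
    then obtain p q where pq: "p \<in> set vs" "q \<in> set vs" "(p, q) \<in> A" "(q, z) \<in> A" "(z, p) \<in> A"
      by blast
    then obtain j k where jk: "j < length vs" "p = vs ! j" "k < length vs" "q = vs ! k"
      by (auto simp: in_set_conv_nth)
    have "j < k" using arc[of j k] jk pq(3) by simp
    \<comment> \<open>The vertex \<open>p\<close> is not \<open>a\<close>, because the arc between
      \<open>a\<close> and \<open>z\<close> starts at \<open>a\<close>. If \<open>p\<close> precedes
      \<open>a\<close>, then \<open>p\<close> serves as \<open>u\<close>. Otherwise \<open>p\<close>
      is \<open>b\<close> or later, hence \<open>q\<close> comes after \<open>b\<close> and serves
      as \<open>u\<close>.\<close>
    have "j \<noteq> i" using pq(5) za jk by auto
    then consider "j < i" | "i < j" by linarith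
    then show ?thesis
    proof cases
      case 1
      then have "(p, ?a) \<in> A" using arc[of j i] jk i by simp
      then have "separator A ?a ?b z p" using ab z az zb pq by (simp add: separator_def)
      then show ?thesis using z(1) pq(1) vs(1) by blast
    next
      case 2
      then have "(?b, q) \<in> A" using arc[of "Suc i" k] \<open>j < k\<close> jk i by simp
      then have "separator A ?a ?b z q" using ab z az zb pq by (simp add: separator_def)
      then show ?thesis using z(1) pq(2) vs(1) by blast
    qed
  qed
qed

section \<open>Pigeonhole along a longest chain\<close>

lemma large_fibre:
  assumes "finite Q" "finite Y" "f ` Q \<subseteq> Y" "Y \<noteq> {}" "m * card Y \<le> card Q"
  shows "\<exists>y\<in>Y. m \<le> card {x \<in> Q. f x = y}"
proof (rule ccontr)
  assume "\<not> ?thesis"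
  then have "(\<Sum>y\<in>Y. card {x \<in> Q. f x = y}) < (\<Sum>y\<in>Y. m)"
    using assms by (intro sum_strict_mono) auto
  moreover have "(\<Sum>y\<in>Y. card {x \<in> Q. f x = y}) = card Q"
    using sum.group[OF assms(1-3), of "\<lambda>_. 1 :: nat"] by simp
  ultimately show False using assms(5) by (simp add: mult.commute)
qed


lemma many_blocks_imp_many_large_blocks:
  fixes l m :: nat
  assumes T: "tournament_on A S" and fin: "finite S" and m: "0 < m"
    and many: "2 ^ (l * (m * 2 ^ (2 * l) + 2 * l + 2)) \<le> card (S // same_block A S)"
  shows "\<exists>S'\<subseteq>S. l \<le> card {B \<in> S' // same_block A S'. m \<le> card B}"
proof -
  \<comment> \<open>The chain is cut into \<open>l\<close> segments of length \<open>d\<close>. In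
    each, 2 positions hold the separated pair, at most \<open>2 * l\<close> are lost to separating
    vertices lying on the chain, and \<open>m * 2 ^ (2 * l)\<close> vertices yield \<open>m\<close>
    that agree in their arcs to the at most \<open>2 * l\<close> separating vertices. A chain of
    length \<open>l * d\<close> exists among \<open>2 ^ (l * d)\<close> representatives.\<close>
  define d where "d = m * 2 ^ (2 * l) + 2 * l + 2"
  obtain R where R: "R \<subseteq> S" "card R = card (S // same_block A S)" "same_block A R \<subseteq> Id"
    using block_representatives[OF T] by blast
  have TR: "tournament_on A R" and finR: "finite R"
    using tournament_on_subset[OF T R(1)] finite_subset[OF R(1) fin] by blast+
  define V where "V = arg_max card (\<lambda>V. V \<subseteq> R \<and> transitive_set A V)"
  have "R \<supseteq> {} \<and> transitive_set A {}" by (simp add: transitive_set_def)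
  moreover have "\<forall>V. V \<subseteq> R \<and> transitive_set A V \<longrightarrow> card V \<le> card R"
    using finR by (simp add: card_mono)
  ultimately have V: "V \<subseteq> R" "transitive_set A V"
    and max: "\<And>V'. V' \<subseteq> R \<Longrightarrow> transitive_set A V' \<Longrightarrow> card V' \<le> card V"
    using arg_max_nat_lemma[of "\<lambda>V. V \<subseteq> R \<and> transitive_set A V" "{}" card "Suc (card R)"]
    unfolding V_def by (auto simp: less_Suc_eq_le)
  have "2 ^ (l * d) \<le> card R" using many R(2) by (simp add: d_def)
  then have len: "l * d \<le> card V"
    using transitive_subset_exists[OF finR TR] max by (meson order_trans)
  have finV: "finite V" using finite_subset[OF V(1) finR] .
  obtain vs where vs: "set vs = V" "distinct vs" "sorted_wrt (\<lambda>x y. (x, y) \<in> A) vs"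
    using transitive_list[OF finV tournament_on_subset[OF TR V(1)] V(2)] .
  have lenvs: "length vs = card V" using vs(1,2) distinct_card by fastforce
  have vsR: "set vs \<subseteq> R" using vs(1) V(1) by simp
  note arc = sorted_arc_iff[OF TR vsR vs(3)]
  have step: "s * d + d \<le> t * d" if "s < t" for s t
    using mult_le_mono1[of "Suc s" t d] that by simp
  have bound: "s * d + d \<le> length vs" if "s < l" for s
    using step[OF that] len lenvs by simp
  have d2: "2 \<le> d" by (simp add: d_def)
  have "\<exists>z\<in>R. \<exists>u\<in>R. separator A (vs ! (s * d)) (vs ! Suc (s * d)) z u" if "s < l" for s
  proof (rule separator_exists[OF TR finR vsR vs(2,3)])
    show i: "Suc (s * d) < length vs" using bound[OF that] d2 by linarith
    show "card V' \<le> length vs" if "V' \<subseteq> R" "transitive_set A V'" for V'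
      using max[OF that] lenvs by simp
    show "transitive_set A (set vs)" using V(2) vs(1) by simp
    have "vs ! (s * d) \<noteq> vs ! Suc (s * d)"
      using vs(2) i by (simp add: nth_eq_iff_index_eq)
    then show "(vs ! (s * d), vs ! Suc (s * d)) \<notin> same_block A R" using R(3) by auto
  qed
  then obtain z u where zu: "\<And>s. s < l \<Longrightarrow> z s \<in> R"  "\<And>s. s < l \<Longrightarrow> u s \<in> R"
      "\<And>s. s < l \<Longrightarrow> separator A (vs ! (s * d)) (vs ! Suc (s * d)) (z s) (u s)"
    by metis
  define W where "W = z ` {..<l} \<union> u ` {..<l}"
  have finW: "finite W" by (simp add: W_def)
  have WR: "W \<subseteq> R" using zu(1,2) by (auto simp: W_def)
  have "card W \<le> card (z ` {..<l}) + card (u ` {..<l})" unfolding W_def by (rule card_Un_le)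
  also have "\<dots> \<le> l + l"
    using card_image_le[of "{..<l}" z] card_image_le[of "{..<l}" u] by simp
  finally have cardW: "card W \<le> 2 * l" by simp
  \<comment> \<open>The rest of segment \<open>s\<close>, without \<open>W\<close>, is classified by
    out-neighbourhoods in \<open>W\<close>; there are at most \<open>2 ^ (2 * l)\<close> classes, so
    one of them has \<open>m\<close> members.\<close>
  have "\<exists>G. m \<le> card G \<and> G \<subseteq> (!) vs ` {s * d + 2..<s * d + d} - W \<and>
      (\<forall>w\<in>W. \<forall>x\<in>G. \<forall>y\<in>G. (x, w) \<in> A \<longleftrightarrow> (y, w) \<in> A)" if "s < l" for s
  proof -
    let ?Q = "(!) vs ` {s * d + 2..<s * d + d} - W" and ?f = "\<lambda>x. {w \<in> W. (x, w) \<in> A}"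
    have "inj_on ((!) vs) {s * d + 2..<s * d + d}"
      using vs(2) bound[OF that] by (intro inj_on_nth) auto
    then have "card ((!) vs ` {s * d + 2..<s * d + d}) = d - 2" by (simp add: card_image)
    then have "d - 2 - card W \<le> card ?Q" using diff_card_le_card_Diff[OF finW] by metis
    then have Q: "m * 2 ^ (2 * l) \<le> card ?Q" using cardW by (simp add: d_def)
    have "m * card (Pow W) \<le> m * 2 ^ (2 * l)"
      using cardW finW by (simp add: card_Pow power_increasing)
    with Q have "m * card (Pow W) \<le> card ?Q" by linarith
    then obtain X where X: "m \<le> card {x \<in> ?Q. ?f x = X}"
      using large_fibre[of ?Q "Pow W" ?f m] finW by blast
    have "(x, w) \<in> A \<longleftrightarrow> (y, w) \<in> A" if "w \<in> W" "?f x = X" "?f y = X" for w x y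
      using that by blast
    then have "\<forall>w\<in>W. \<forall>x\<in>{x \<in> ?Q. ?f x = X}. \<forall>y\<in>{x \<in> ?Q. ?f x = X}. (x, w) \<in> A \<longleftrightarrow> (y, w) \<in> A"
      by simp
    with X show ?thesis by blast
  qed
  then obtain G where cardG: "\<And>s. s < l \<Longrightarrow> m \<le> card (G s)"
    and Gsub: "\<And>s. s < l \<Longrightarrow> G s \<subseteq> (!) vs ` {s * d + 2..<s * d + d} - W"
    and Gcong: "\<And>s. s < l \<Longrightarrow> \<forall>w\<in>W. \<forall>x\<in>G s. \<forall>y\<in>G s. (x, w) \<in> A \<longleftrightarrow> (y, w) \<in> A"
    by metis
  have Gidx: "\<exists>j. x = vs ! j \<and> s * d + 2 \<le> j \<and> j < s * d + d" if "s < l" "x \<in> G s" for s x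
  proof -
    have "x \<in> (!) vs ` {s * d + 2..<s * d + d}" using Gsub[OF that(1)] that(2) by blast
    then show ?thesis by auto
  qed
  define S' where "S' = W \<union> (\<Union>s<l. insert (vs ! (s * d)) (insert (vs ! Suc (s * d)) (G s)))"
  have pts: "vs ! (s * d) \<in> S'" "vs ! Suc (s * d) \<in> S'" "G s \<subseteq> S'" "z s \<in> S'" "u s \<in> S'"
    if "s < l" for s
    using that unfolding S'_def W_def by blast+
  \<comment> \<open>Apart from \<open>W\<close> and \<open>G s\<close>, all that remains in
    \<open>S'\<close> lies on the chain before or after the stretch containing \<open>G s\<close>,
    and therefore sees the whole of \<open>G s\<close> alike.\<close>
  have idx: "\<exists>k < length vs. x = vs ! k \<and> (k < s * d + 2 \<or> s * d + d \<le> k)"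
    if x: "x \<in> S'" "x \<notin> W" "x \<notin> G s" and "s < l" for x s
  proof -
    obtain t where t: "t < l" "x = vs ! (t * d) \<or> x = vs ! Suc (t * d) \<or> x \<in> G t"
      using x(1,2) unfolding S'_def by blast
    have "\<exists>k. x = vs ! k \<and> t * d \<le> k \<and> k < t * d + d \<and> (t = s \<longrightarrow> k < s * d + 2)"
      using t(2)
    proof (elim disjE)
      show ?thesis if "x = vs ! (t * d)" using that d2 by (intro exI[of _ "t * d"]) simp
      show ?thesis if "x = vs ! Suc (t * d)" using that d2 by (intro exI[of _ "Suc (t * d)"]) simp
      assume xt: "x \<in> G t"
      then have "t \<noteq> s" using x(3) by blast
      with Gidx[OF t(1) xt] show ?thesis by auto
    qed
    then obtain k where k: "x = vs ! k" "t * d \<le> k" "k < t * d + d" "t = s \<longrightarrow> k < s * d + 2"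
      by blast
    have "k < length vs" using bound[OF t(1)] k(3) by linarith
    moreover consider "t < s" | "t = s" | "s < t" by linarith
    then have "k < s * d + 2 \<or> s * d + d \<le> k"
    proof cases
      case 1
      then show ?thesis using step[OF 1] k(3) by linarith
    next
      case 3
      then show ?thesis using step[OF 3] k(2) by linarith
    qed (use k(4) in blast)
    ultimately show ?thesis using k(1) by blast
  qed
  have GV: "G s \<subseteq> V" if s: "s < l" for s
  proof
    fix x assume "x \<in> G s"
    then obtain j where "x = vs ! j" "j < s * d + d" using Gidx[OF s] by blast
    then show "x \<in> V" using bound[OF s] vs(1) nth_mem[of j vs] by simp
  qed
  have "S' \<subseteq> R"
  proof -
    have "vs ! (s * d) \<in> R" "vs ! Suc (s * d) \<in> R" if "s < l" for s
      using bound[OF that] d2 vsR nth_mem[of "s * d" vs] nth_mem[of "Suc (s * d)" vs] by auto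
    then show ?thesis using WR GV V(1) unfolding S'_def by blast
  qed
  then have TS': "tournament_on A S'" and S'S: "S' \<subseteq> S"
    using tournament_on_subset[OF TR] R(1) by blast+
  \<comment> \<open>Vertices of \<open>W\<close> do not distinguish members of \<open>G s\<close> by
    the choice of \<open>G\<close>, other vertices of \<open>S'\<close> do not by their position on
    the chain.\<close>
  have module: "transitive_module A S' (G s)" if s: "s < l" for s
    unfolding transitive_module_def
  proof (intro conjI ballI)
    show "G s \<subseteq> S'" using pts(3)[OF s] .
    show "transitive_set A (G s)" using transitive_set_subset[OF V(2) GV[OF s]] .
    fix x y y' assume x: "x \<in> S' - G s" and y: "y \<in> G s" and y': "y' \<in> G s"
    show "(x, y) \<in> A \<longleftrightarrow> (x, y') \<in> A"
    proof (cases "x \<in> W")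
      case True
      have inS': "x \<in> S'" "y \<in> S'" "y' \<in> S'" "x \<noteq> y" "x \<noteq> y'" using x y y' pts(3)[OF s] by blast+
      have "(y, x) \<in> A \<longleftrightarrow> (y', x) \<in> A" using Gcong[OF s] True y y' by blast
      then show ?thesis
        using tournament_on_swap[OF TS' inS'(1,2,4)] tournament_on_swap[OF TS' inS'(1,3,5)] by argo
    next
      case False
      obtain k where k: "k < length vs" "x = vs ! k" "k < s * d + 2 \<or> s * d + d \<le> k"
        using idx[OF _ False _ s] x by blast
      have "(x, y) \<in> A \<longleftrightarrow> k < s * d + 2" if yG: "y \<in> G s" for y
      proof -
        obtain j where j: "y = vs ! j" "s * d + 2 \<le> j" "j < s * d + d" using Gidx[OF s yG] by blast
        then have "(x, y) \<in> A \<longleftrightarrow> k < j" using arc[of k j] k(1,2) bound[OF s] by simp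
        then show ?thesis using j k(3) by linarith
      qed
      then show ?thesis using y y' by blast
    qed
  qed
  \<comment> \<open>The pair opening segment \<open>t\<close> lies on the chain after
    \<open>G s\<close> and before \<open>G t\<close>. A module meeting both groups must contain
    whatever lies between, hence this pair, but its separator is still present in
    \<open>S'\<close>.\<close>
  have apart: "(g, h) \<notin> same_block A S'" if st: "s < t" "t < l" and g: "g \<in> G s" and h: "h \<in> G t"
    for s t g h
  proof
    assume "(g, h) \<in> same_block A S'"
    then obtain C where C: "transitive_module A S' C" "g \<in> C" "h \<in> C" by (rule same_blockE)
    have s: "s < l" using st by simp
    obtain i where i: "g = vs ! i" "i < s * d + d" using Gidx[OF s g] by blast
    obtain j where j: "h = vs ! j" "t * d + 2 \<le> j" "j < t * d + d" using Gidx[OF st(2) h] by blast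
    note ineqs = i(2) j(2,3) bound[OF st(2)] bound[OF s] step[OF st(1)] d2
    have mid: "vs ! k \<in> C" if "t * d \<le> k" "k < t * d + 2" "vs ! k \<in> S'" for k
    proof (rule ccontr)
      assume "vs ! k \<notin> C"
      then have "(vs ! k, g) \<in> A \<longleftrightarrow> (vs ! k, h) \<in> A"
        using transitive_moduleD(3)[OF C(1) that(3) _ C(2,3)] by blast
      moreover have "i < k" "k < j" "i < length vs" "j < length vs" "k < length vs"
        using ineqs that(1,2) by linarith+
      ultimately show False using arc[of k i] arc[of k j] i(1) j(1) by simp
    qed
    have "vs ! (t * d) \<in> C" "vs ! Suc (t * d) \<in> C"
      using mid[of "t * d"] mid[of "Suc (t * d)"] pts(1,2)[OF st(2)] by simp_all
    then have "(vs ! (t * d), vs ! Suc (t * d)) \<in> same_block A S'"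
      by (rule same_blockI[OF C(1)])
    then show False
      using separator_not_same_block[OF TS' pts(4,5)[OF st(2)] zu(3)[OF st(2)]] by blast
  qed
  have "\<exists>g. g \<in> G s" if "s < l" for s
  proof -
    have "G s \<noteq> {}" using cardG[OF that] m by auto
    then show ?thesis by blast
  qed
  then obtain g where g: "\<And>s. s < l \<Longrightarrow> g s \<in> G s" by metis
  let ?Bl = "\<lambda>s. same_block A S' `` {g s}"
  have finS': "finite S'" using finite_subset[OF S'S fin] .
  note eq = equiv_same_block[OF TS']
  have gS': "g s \<in> S'" if "s < l" for s using g[OF that] pts(3)[OF that] by blast
  have "inj_on ?Bl {..<l}"
  proof (rule linorder_inj_onI)
    fix s t assume "s < t" "s \<in> {..<l}" "t \<in> {..<l}"
    then show "?Bl s \<noteq> ?Bl t"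
      using apart[of s t "g s" "g t"] g eq_equiv_class[OF _ eq gS'[of t], of "g s"] by blast
  qed auto
  then have "card (?Bl ` {..<l}) = l" by (simp add: card_image)
  moreover have "?Bl ` {..<l} \<subseteq> {B \<in> S' // same_block A S'. m \<le> card B}"
  proof
    fix B assume "B \<in> ?Bl ` {..<l}"
    then obtain s where s: "s < l" "B = ?Bl s" by blast
    have "G s \<subseteq> B"
    proof
      fix x assume "x \<in> G s"
      then have "(g s, x) \<in> same_block A S'" by (rule same_blockI[OF module[OF s(1)] g[OF s(1)]])
      then show "x \<in> B" using s(2) by blast
    qed
    moreover have B: "B \<in> S' // same_block A S'" unfolding s(2) using gS'[OF s(1)] by (rule quotientI)
    moreover have "finite B"
      using finite_subset[OF in_quotient_imp_subset[OF eq B] finS'] .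
    ultimately show "B \<in> {B \<in> S' // same_block A S'. m \<le> card B}"
      using cardG[OF s(1)] card_mono[of B "G s"] by simp
  qed
  moreover have "finite {B \<in> S' // same_block A S'. m \<le> card B}"
    by (rule finite_subset[OF _ finite_quotient[OF finS' equiv_type[OF eq]]]) blast
  ultimately have "l \<le> card {B \<in> S' // same_block A S'. m \<le> card B}"
    using card_mono[of "{B \<in> S' // same_block A S'. m \<le> card B}" "?Bl ` {..<l}"] by linarith
  with S'S show ?thesis by blast
qed

section \<open>The upper bound\<close>

lemma digraph_iso_bij:
  assumes T: "tournament T" and H: "tournament H"
    and iso: "digraph_iso (with_proj T) (with_proj H)"
  obtains f where "bij_betw f (pverts T) (pverts H)"
    "\<And>x y. x \<in> pverts T \<Longrightarrow> y \<in> pverts T \<Longrightarrow> (f x, f y) \<in> parcs H \<longleftrightarrow> (x, y) \<in> parcs T"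
proof -
  obtain h where h: "pre_digraph.digraph_isomorphism (with_proj T) h" "with_proj H = app_iso h (with_proj T)"
    using iso unfolding digraph_iso_def by blast
  let ?f = "iso_verts h"
  have inj: "inj_on ?f (pverts T)"
    and arc: "\<And>a. a \<in> parcs T \<Longrightarrow> ?f (fst a) = iso_tail h (iso_arcs h a) \<and> ?f (snd a) = iso_head h (iso_arcs h a)"
    using h(1) unfolding pre_digraph.digraph_isomorphism_def by simp_all
  \<comment> \<open>Both digraphs come from \<open>with_proj\<close>, so the new tail and head maps
    must be \<open>fst\<close> and \<open>snd\<close>, and the arc map is the one induced by the
    vertex map.\<close>
  have V: "pverts H = ?f ` pverts T" and P: "parcs H = iso_arcs h ` parcs T"
    and tail: "iso_tail h = fst" and head: "iso_head h = snd"
    using arg_cong[OF h(2), of verts] arg_cong[OF h(2), of arcs] arg_cong[OF h(2), of tail]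
      arg_cong[OF h(2), of head] by simp_all
  have img: "iso_arcs h (x, y) = (?f x, ?f y)" if "(x, y) \<in> parcs T" for x y
    using arc[OF that] tail head by (simp add: prod_eq_iff)
  have "(?f x, ?f y) \<in> parcs H \<longleftrightarrow> (x, y) \<in> parcs T" if xy: "x \<in> pverts T" "y \<in> pverts T" for x y
  proof
    assume "(x, y) \<in> parcs T"
    then show "(?f x, ?f y) \<in> parcs H" using img P by (metis imageI)
  next
    assume "(?f x, ?f y) \<in> parcs H"
    then obtain a b where ab: "(a, b) \<in> parcs T" "(?f x, ?f y) = iso_arcs h (a, b)"
      unfolding P by auto
    then have "?f x = ?f a" "?f y = ?f b" using img by simp_all
    moreover have "a \<in> pverts T" "b \<in> pverts T" using tournament_arcs_subset[OF T] ab(1) by blast+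
    ultimately have "x = a" "y = b" using inj xy by (simp_all add: inj_on_eq_iff)
    then show "(x, y) \<in> parcs T" using ab(1) by simp
  qed
  moreover have "bij_betw ?f (pverts T) (pverts H)" using inj V by (simp add: bij_betw_def)
  ultimately show ?thesis using that by blast
qed

lemma bij_digraph_iso:
  assumes T: "tournament T" and H: "tournament H"
    and f: "bij_betw f (pverts T) (pverts H)"
    and arcs: "\<And>x y. x \<in> pverts T \<Longrightarrow> y \<in> pverts T \<Longrightarrow> (f x, f y) \<in> parcs H \<longleftrightarrow> (x, y) \<in> parcs T"
  shows "digraph_iso (with_proj T) (with_proj H)"
proof -
  interpret tournament T by fact
  let ?h = "\<lparr>iso_verts = f, iso_arcs = map_prod f f, iso_head = snd, iso_tail = fst\<rparr>"
  note subT = tournament_arcs_subset[OF T] and subH = tournament_arcs_subset[OF H]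
  have inj: "inj_on f (pverts T)" and im: "f ` pverts T = pverts H"
    using f by (simp_all add: bij_betw_def)
  have "inj_on (map_prod f f) (parcs T)"
    using inj_on_subset[OF map_prod_inj_on[OF inj inj] subT] .
  then have "pre_digraph.digraph_isomorphism (with_proj T) ?h"
    using inj wf_digraph_axioms unfolding pre_digraph.digraph_isomorphism_def by simp
  moreover have "parcs H = map_prod f f ` parcs T"
  proof
    show "parcs H \<subseteq> map_prod f f ` parcs T"
    proof
      fix e assume e: "e \<in> parcs H"
      then obtain u v where uv: "u \<in> pverts T" "v \<in> pverts T" "e = (f u, f v)"
        using subH unfolding im[symmetric] by blast
      then have "(u, v) \<in> parcs T" using arcs e by blast
      then show "e \<in> map_prod f f ` parcs T" using uv(3) by (metis map_prod_simp imageI)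
    qed
    show "map_prod f f ` parcs T \<subseteq> parcs H"
    proof
      fix e assume "e \<in> map_prod f f ` parcs T"
      then obtain u v where uv: "(u, v) \<in> parcs T" "e = (f u, f v)" by auto
      then have "u \<in> pverts T" "v \<in> pverts T" using subT by blast+
      then show "e \<in> parcs H" using arcs uv by blast
    qed
  qed
  then have "with_proj H = app_iso ?h (with_proj T)"
    using im by (simp add: app_iso_def with_proj_def)
  ultimately show ?thesis unfolding digraph_iso_def by blast
qed

text \<open>A code for a tournament up to isomorphism: \<open>D\<close> prescribes the arcs between
  blocks and \<open>xs\<close> lists the block sizes. The coordinates \<open>(i, p)\<close> stand
  for the vertex at position \<open>p\<close> in the linear order of block \<open>i\<close>.\<close>

definition represents :: "nat rel \<Rightarrow> nat list \<Rightarrow> 'a pair_pre_digraph \<Rightarrow> bool" where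
  "represents D xs T \<longleftrightarrow>
     (\<exists>g. bij_betw g (SIGMA i:{..<length xs}. {..<xs ! i}) (pverts T) \<and>
        (\<forall>i<length xs. \<forall>j<length xs. \<forall>p<xs ! i. \<forall>q<xs ! j.
           (g (i, p), g (j, q)) \<in> parcs T \<longleftrightarrow> (if i = j then p < q else (i, j) \<in> D)))"

lemma represents_iso:
  assumes T: "tournament T" "represents D xs T" and H: "tournament H" "represents D xs H"
  shows "digraph_iso (with_proj T) (with_proj H)"
proof -
  let ?X = "SIGMA i:{..<length xs}. {..<xs ! i}"
  obtain g where g: "bij_betw g ?X (pverts T)"
    "\<forall>i<length xs. \<forall>j<length xs. \<forall>p<xs ! i. \<forall>q<xs ! j.
       (g (i, p), g (j, q)) \<in> parcs T \<longleftrightarrow> (if i = j then p < q else (i, j) \<in> D)"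
    using T(2) unfolding represents_def by blast
  obtain h where h: "bij_betw h ?X (pverts H)"
    "\<forall>i<length xs. \<forall>j<length xs. \<forall>p<xs ! i. \<forall>q<xs ! j.
       (h (i, p), h (j, q)) \<in> parcs H \<longleftrightarrow> (if i = j then p < q else (i, j) \<in> D)"
    using H(2) unfolding represents_def by blast
  let ?f = "h \<circ> inv_into ?X g"
  have gi: "bij_betw (inv_into ?X g) (pverts T) ?X" using g(1) by (rule bij_betw_inv_into)
  have "bij_betw ?f (pverts T) (pverts H)" using gi h(1) by (rule bij_betw_trans)
  moreover have "(?f x, ?f y) \<in> parcs H \<longleftrightarrow> (x, y) \<in> parcs T" if xy: "x \<in> pverts T" "y \<in> pverts T" for x y
  proof -
    obtain i p where ip: "inv_into ?X g x = (i, p)" "i < length xs" "p < xs ! i"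
      using bij_betwE[OF gi] xy(1) by (metis SigmaE lessThan_iff)
    obtain j q where jq: "inv_into ?X g y = (j, q)" "j < length xs" "q < xs ! j"
      using bij_betwE[OF gi] xy(2) by (metis SigmaE lessThan_iff)
    have "x = g (i, p)" "y = g (j, q)"
      using bij_betw_inv_into_right[OF g(1)] xy ip(1) jq(1) by metis+
    then have "(x, y) \<in> parcs T \<longleftrightarrow> (h (i, p), h (j, q)) \<in> parcs H"
      using g(2) h(2) ip(2,3) jq(2,3) by presburger
    then show ?thesis using ip(1) jq(1) by simp
  qed
  ultimately show ?thesis by (rule bij_digraph_iso[OF T(1) H(1)])
qed

text \<open>Each block is a chain, and arcs between different blocks depend only on the blocks; so
  the order of the vertices in each block provides the coordinates.\<close>

lemma represents_blocks:
  assumes T: "tournament T" and Bs: "distinct Bs" "set Bs = homogeneous_blocks T"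
  shows "\<exists>D\<subseteq>{..<length Bs} \<times> {..<length Bs}. represents D (map card Bs) T"
proof -
  let ?A = "parcs T" and ?S = "pverts T"
  let ?E = "same_block ?A ?S"
  note TS = tournament_tournament_on[OF T] and fin = tournament_finite[OF T]
  note eq = equiv_same_block[OF TS]
  have blocks: "set Bs = ?S // ?E" using Bs(2) homogeneous_blocks_eq[OF T] by simp
  have B: "Bs ! i \<in> ?S // ?E" if "i < length Bs" for i using blocks nth_mem[OF that] by simp
  have BS: "Bs ! i \<subseteq> ?S" if "i < length Bs" for i using in_quotient_imp_subset[OF eq B[OF that]] .
  have "\<exists>ys. set ys = Bs ! i \<and> distinct ys \<and> sorted_wrt (\<lambda>x y. (x, y) \<in> ?A) ys" if i: "i < length Bs" for i
    using transitive_list[OF finite_subset[OF BS[OF i] fin] tournament_on_subset[OF TS BS[OF i]]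
        transitive_moduleD(2)[OF transitive_module_block[OF TS B[OF i]]]] by metis
  then obtain L where L: "\<And>i. i < length Bs \<Longrightarrow> set (L i) = Bs ! i" "\<And>i. i < length Bs \<Longrightarrow> distinct (L i)"
      "\<And>i. i < length Bs \<Longrightarrow> sorted_wrt (\<lambda>x y. (x, y) \<in> ?A) (L i)"
    by metis
  have len: "length (L i) = card (Bs ! i)" if "i < length Bs" for i
    using distinct_card[OF L(2)[OF that]] L(1)[OF that] by simp
  \<comment> \<open>For distinct blocks, one arc from the first to the second forces all arcs in
    that direction, by \<open>same_block_arc_cong\<close>.\<close>
  define D where "D = {(i, j). i < length Bs \<and> j < length Bs \<and> (\<exists>x\<in>Bs ! i. \<exists>y\<in>Bs ! j. (x, y) \<in> ?A)}"
  have disj: "i = j" if "i < length Bs" "j < length Bs" "x \<in> Bs ! i" "y \<in> Bs ! j" "(x, y) \<in> ?E" for i j x y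
    using quotient_eq_iff[OF eq B[OF that(1)] B[OF that(2)] that(3,4)] that(5) Bs(1) that(1,2)
    by (simp add: nth_eq_iff_index_eq)
  let ?X = "SIGMA i:{..<length (map card Bs)}. {..<map card Bs ! i}" and ?g = "\<lambda>(i, p). L i ! p"
  have gB: "L i ! p \<in> Bs ! i" if "i < length Bs" "p < card (Bs ! i)" for i p
    using that L(1)[OF that(1)] len[OF that(1)] nth_mem[of p "L i"] by simp
  have refl: "(x, x) \<in> ?E" if "i < length Bs" "x \<in> Bs ! i" for i x
    using same_block_refl[OF TS] BS that by blast
  have "inj_on ?g ?X"
  proof (rule inj_onI)
    fix x y assume x: "x \<in> ?X" and y: "y \<in> ?X" and xy: "?g x = ?g y"
    obtain i p where ip: "x = (i, p)" "i < length Bs" "p < card (Bs ! i)" using x by auto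
    obtain j q where jq: "y = (j, q)" "j < length Bs" "q < card (Bs ! j)" using y by auto
    have e: "L i ! p = L j ! q" using xy ip jq by simp
    have "i = j"
      using disj[OF ip(2) jq(2) gB[OF ip(2,3)] gB[OF jq(2,3)]] refl[OF ip(2) gB[OF ip(2,3)]] e by simp
    moreover have "p = q"
      using e L(2)[OF ip(2)] len[OF ip(2)] ip(3) jq(3) calculation by (simp add: nth_eq_iff_index_eq)
    ultimately show "x = y" using ip jq by simp
  qed
  moreover have "?g ` ?X = ?S"
  proof
    show "?g ` ?X \<subseteq> ?S" using gB BS by fastforce
    show "?S \<subseteq> ?g ` ?X"
    proof
      fix x assume "x \<in> ?S"
      then have "x \<in> \<Union> (set Bs)" using Union_quotient[OF eq] blocks by simp
      then obtain i where i: "i < length Bs" "x \<in> Bs ! i" by (metis UnionE in_set_conv_nth)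
      then obtain p where p: "p < length (L i)" "x = L i ! p"
        using L(1)[OF i(1)] by (metis in_set_conv_nth)
      then show "x \<in> ?g ` ?X"
        using i(1) len[OF i(1)] by (intro image_eqI[of _ _ "(i, p)"]) auto
    qed
  qed
  ultimately have bij: "bij_betw ?g ?X ?S" by (simp add: bij_betw_def)
  have arcs: "(L i ! p, L j ! q) \<in> ?A \<longleftrightarrow> (if i = j then p < q else (i, j) \<in> D)"
    if i: "i < length Bs" and j: "j < length Bs" and p: "p < card (Bs ! i)" and q: "q < card (Bs ! j)"
    for i j p q
  proof (cases "i = j")
    case True
    have "set (L i) \<subseteq> ?S" using L(1)[OF i] BS[OF i] by simp
    then show ?thesis
      using sorted_arc_iff[OF TS _ L(3)[OF i], of p q] p q len[OF i] True by simp
  next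
    case False
    let ?x = "L i ! p" and ?y = "L j ! q"
    have x: "?x \<in> Bs ! i" and y: "?y \<in> Bs ! j" using gB i j p q by blast+
    have "(i, j) \<in> D \<longleftrightarrow> (?x, ?y) \<in> ?A"
    proof
      assume "(i, j) \<in> D"
      then obtain x' y' where xy': "x' \<in> Bs ! i" "y' \<in> Bs ! j" "(x', y') \<in> ?A" unfolding D_def by blast
      have "(x', ?x) \<in> ?E" "(y', ?y) \<in> ?E"
        using quotient_eq_iff[OF eq B[OF i] B[OF i] xy'(1) x] quotient_eq_iff[OF eq B[OF j] B[OF j] xy'(2) y]
        by simp_all
      moreover have "(x', y') \<notin> ?E" using disj[OF i j xy'(1,2)] False by blast
      ultimately show "(?x, ?y) \<in> ?A" using same_block_arc_cong[OF TS] xy'(3) by metis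
    next
      assume "(?x, ?y) \<in> ?A"
      then show "(i, j) \<in> D" unfolding D_def using i j x y by blast
    qed
    then show ?thesis using False by simp
  qed
  have "represents D (map card Bs) T"
    unfolding represents_def using bij arcs by (intro exI[of _ ?g]) auto
  moreover have "D \<subseteq> {..<length Bs} \<times> {..<length Bs}" by (auto simp: D_def)
  ultimately show ?thesis by blast
qed

text \<open>Members of \<open>P\<close> with the same code are isomorphic by
  \<open>represents_iso\<close>, so a code may be sent to the class of any member that it
  represents. Codes representing no member receive an arbitrary value, which is harmless for an
  inclusion.\<close>

lemma level_subset_image:
  assumes P: "hereditary_property P"
    and codes: "\<And>T. T \<in> P \<Longrightarrow> card (pverts T) = n \<Longrightarrow> \<exists>c\<in>X. represents (fst c) (snd c) T"
  shows "\<exists>h. level P n \<subseteq> h ` X"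
proof -
  have tour: "\<And>T. T \<in> P \<Longrightarrow> tournament T" using P unfolding hereditary_property_def by blast
  define r where "r = (\<lambda>c. SOME T. T \<in> P \<and> represents (fst c) (snd c) T)"
  have "level P n \<subseteq> (\<lambda>c. iso_rel `` {r c}) ` X"
  proof
    fix Y assume "Y \<in> level P n"
    then obtain T where T: "T \<in> P" "card (pverts T) = n" "Y = iso_rel `` {T}"
      unfolding level_def by (auto elim: quotientE)
    obtain c where c: "c \<in> X" "represents (fst c) (snd c) T" using codes[OF T(1,2)] by blast
    then have r: "r c \<in> P" "represents (fst c) (snd c) (r c)"
      using someI[of "\<lambda>T. T \<in> P \<and> represents (fst c) (snd c) T" T] T(1) unfolding r_def by blast+
    have "digraph_iso (with_proj T) (with_proj (r c))" "digraph_iso (with_proj (r c)) (with_proj T)"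
      using represents_iso tour T(1) c(2) r by metis+
    then have "Y = iso_rel `` {r c}"
      unfolding T(3) iso_rel_def using digraph_iso_trans by blast
    then show "Y \<in> (\<lambda>c. iso_rel `` {r c}) ` X" using c(1) by blast
  qed
  then show ?thesis by blast
qed

lemma card_short_lists:
  "finite {xs :: nat list. set xs \<subseteq> {..n} \<and> length xs \<le> k}"
  "card {xs :: nat list. set xs \<subseteq> {..n} \<and> length xs \<le> k} \<le> Suc k * (n + 1) ^ k"
proof -
  show "finite {xs :: nat list. set xs \<subseteq> {..n} \<and> length xs \<le> k}"
    by (rule finite_lists_length_le) simp
  have "card {xs :: nat list. set xs \<subseteq> {..n} \<and> length xs \<le> k} = (\<Sum>i\<le>k. (n + 1) ^ i)"
    by (subst card_lists_length_le) simp_all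
  also have "\<dots> \<le> (\<Sum>i\<le>k. (n + 1) ^ k)"
    by (intro sum_mono power_increasing) simp_all
  finally show "card {xs :: nat list. set xs \<subseteq> {..n} \<and> length xs \<le> k} \<le> Suc k * (n + 1) ^ k" by simp
qed

abbreviation num_large_blocks :: "nat \<Rightarrow> 'a pair_pre_digraph \<Rightarrow> nat" where
  "num_large_blocks m T \<equiv> card {B \<in> homogeneous_blocks T. m \<le> card B}"

lemma card_pverts_blocks:
  assumes T: "tournament T" and Bs: "distinct Bs" "set Bs = homogeneous_blocks T"
  shows "sum_list (map card Bs) = card (pverts T)"
proof -
  note TS = tournament_tournament_on[OF T] and fin = tournament_finite[OF T]
  note eq = equiv_same_block[OF TS]
  have "sum_list (map card Bs) = sum card (set Bs)" using Bs(1) by (simp add: sum_list_distinct_conv_sum_set)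
  also have "\<dots> = card (\<Union> (set Bs))"
    unfolding Bs(2) homogeneous_blocks_eq[OF T]
    by (rule card_Union_disjoint[symmetric])
      (use quotient_disj[OF eq] finite_subset[OF in_quotient_imp_subset[OF eq] fin] in
        \<open>auto simp: pairwise_def disjnt_def\<close>)
  also have "\<dots> = card (pverts T)"
    unfolding Bs(2) homogeneous_blocks_eq[OF T] Union_quotient[OF eq] ..
  finally show ?thesis .
qed

text \<open>With at most \<open>K\<close> blocks there are boundedly many arc patterns and boundedly
  many lists of small sizes. Only the at most \<open>k + 1\<close> large sizes grow with
  \<open>n\<close>, and the total ties them together, leaving \<open>k\<close> free
  parameters.\<close>

lemma card_level_le:
  assumes P: "hereditary_property P"
    and K: "\<And>T. T \<in> P \<Longrightarrow> card (homogeneous_blocks T) \<le> K"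
    and M: "\<And>T. T \<in> P \<Longrightarrow> num_large_blocks M T \<le> Suc k"
  shows "\<exists>C. \<forall>n. finite (level P n) \<and> card (level P n) \<le> C * (n + 1) ^ k"
proof -
  define Ys where "Ys = {ys :: nat list. set ys \<subseteq> {..M} \<and> length ys \<le> K}"
  define Xs where "Xs = (\<lambda>n. {xs :: nat list. set xs \<subseteq> {..n} \<and> length xs \<le> k})"
  define Z where "Z = (\<lambda>n. Pow ({..<K} \<times> {..<K}) \<times> Ys \<times> (UNIV :: bool set) \<times> Xs n)"
  \<comment> \<open>The size of the first large block is not stored, as it can be recovered from \<open>n\<close>; this saves one
    factor \<open>n + 1\<close>. The flag tells whether there is a large block at all.\<close>
  define code where "code = (\<lambda>n :: nat. \<lambda>(D :: nat rel, ys, b, xs).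
      (D, (if b then [] else (n - sum_list ys - sum_list xs) # xs) @ ys))"
  have finYs: "finite Ys" and finXs: "\<And>n. finite (Xs n)"
    unfolding Ys_def Xs_def by (rule card_short_lists)+
  have finZ: "finite (Z n)" for n
    unfolding Z_def using finYs finXs by (intro finite_cartesian_product) simp_all
  \<comment> \<open>The factors count the arc patterns, the lists of small sizes, the flag, and the
    crude estimate in \<open>card_short_lists\<close>.\<close>
  let ?C = "2 ^ (K * K) * (card Ys * (2 * Suc k))"
  have "finite (level P n) \<and> card (level P n) \<le> ?C * (n + 1) ^ k" for n
  proof -
    have "\<exists>h. level P n \<subseteq> h ` (code n ` Z n)"
    proof (rule level_subset_image[OF P])
      fix T assume TP: "T \<in> P" and n: "card (pverts T) = n"
      have T: "tournament T" using P TP unfolding hereditary_property_def by blast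
      let ?H = "homogeneous_blocks T"
      have finH: "finite ?H" using finite_homogeneous_blocks[OF T] .
      obtain Ls where Ls: "set Ls = {B \<in> ?H. M \<le> card B}" "distinct Ls"
        using finite_distinct_list[of "{B \<in> ?H. M \<le> card B}"] finH by auto
      obtain Ss where Ss: "set Ss = {B \<in> ?H. card B < M}" "distinct Ss"
        using finite_distinct_list[of "{B \<in> ?H. card B < M}"] finH by auto
      have Bs: "distinct (Ls @ Ss)" "set (Ls @ Ss) = ?H" using Ls Ss by auto
      have lenBs: "length (Ls @ Ss) \<le> K" using distinct_card[OF Bs(1)] Bs(2) K[OF TP] by simp
      have lenLs: "length Ls \<le> Suc k" using distinct_card[OF Ls(2)] Ls(1) M[OF TP] by simp
      have sum: "sum_list (map card Ls) + sum_list (map card Ss) = n"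
        using card_pverts_blocks[OF T Bs] n by simp
      obtain D where D: "D \<subseteq> {..<length (Ls @ Ss)} \<times> {..<length (Ls @ Ss)}"
          "represents D (map card (Ls @ Ss)) T"
        using represents_blocks[OF T Bs] by blast
      \<comment> \<open>Large blocks are listed first, so the size dropped by \<open>tl\<close> is
        that of a large block; if there is none, \<open>tl\<close> returns the empty list.\<close>
      let ?ys = "map card Ss" and ?xs = "tl (map card Ls)"
      have "D \<in> Pow ({..<K} \<times> {..<K})" using D(1) lenBs by fastforce
      moreover have "?ys \<in> Ys" using Ss(1) lenBs unfolding Ys_def by auto
      moreover have "?xs \<in> Xs n"
      proof -
        have "x \<le> n" if "x \<in> set (map card Ls)" for x
          using member_le_sum_list[OF that] sum by linarith
        moreover have "set ?xs \<subseteq> set (map card Ls)" by (cases Ls) auto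
        ultimately have "set ?xs \<subseteq> {..n}" by blast
        then show ?thesis using lenLs unfolding Xs_def by simp
      qed
      ultimately have Zmem: "(D, ?ys, Ls = [], ?xs) \<in> Z n" unfolding Z_def by simp
      have "code n (D, ?ys, Ls = [], ?xs) = (D, map card (Ls @ Ss))"
        using sum unfolding code_def by (cases Ls) auto
      then show "\<exists>c\<in>code n ` Z n. represents (fst c) (snd c) T"
        using D(2) Zmem by (metis fst_conv image_eqI snd_conv)
    qed
    then obtain h where h: "level P n \<subseteq> (h \<circ> code n) ` Z n" by (auto simp: image_comp)
    have "card (level P n) \<le> card (Z n)"
      using card_mono[OF _ h] card_image_le[OF finZ, of "h \<circ> code n" n] finZ by (meson finite_imageI le_trans)
    also have "card (Z n) = 2 ^ (K * K) * (card Ys * (2 * card (Xs n)))"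
      unfolding Z_def by (simp add: card_cartesian_product card_Pow)
    also have "\<dots> \<le> 2 ^ (K * K) * (card Ys * (2 * (Suc k * (n + 1) ^ k)))"
      unfolding Xs_def by (intro mult_le_mono order_refl card_short_lists)
    also have "\<dots> = ?C * (n + 1) ^ k" by (simp only: mult.assoc)
    finally show ?thesis using finite_subset[OF h] finZ by blast
  qed
  then show ?thesis by blast
qed

section \<open>The lower bound\<close>

lemma num_large_blocks_antimono:
  assumes "tournament T" "m \<le> m'"
  shows "num_large_blocks m' T \<le> num_large_blocks m T"
  using assms(2) finite_homogeneous_blocks[OF assms(1)] by (intro card_mono) auto

text \<open>The admissible \<open>l\<close> form an initial segment, since more than
  \<open>l\<close> large blocks are also more than any smaller number. Their number \<open>c\<close>
  is the \<open>k + 1\<close> of the informal argument; \<open>c = 0\<close> matches the supremum of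
  the empty set.\<close>

lemma block_number_cases:
  assumes P: "hereditary_property P" and fin: "block_number P < \<infinity>"
  obtains c where "\<And>l. (\<forall>m. \<exists>T\<in>P. l < num_large_blocks m T) \<longleftrightarrow> l < c"
    "block_number P = (if c = 0 then - \<infinity> else ereal (real (c - 1)))"
proof -
  define L where "L = {l. \<forall>m. \<exists>T\<in>P. l < num_large_blocks m T}"
  have tour: "\<And>T. T \<in> P \<Longrightarrow> tournament T" using P unfolding hereditary_property_def by blast
  have "{l. \<forall>m. \<exists>T\<in>P. l < length (block_sizes T) \<and> m \<le> block_sizes T ! l} = L"
    unfolding L_def
    by (intro Collect_cong all_cong1 bex_cong refl block_sizes_nth_ge_iff finite_homogeneous_blocks tour)
  then have bn: "block_number P = (SUP l\<in>L. ereal (real l))" by (simp add: block_number_def)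
  have "\<exists>l. l \<notin> L"
  proof (rule ccontr)
    assume "\<not> (\<exists>l. l \<notin> L)"
    then have L: "L = UNIV" by blast
    have "block_number P = \<infinity>"
      unfolding bn L by (rule SUP_PInfty) (meson ereal_less_eq(3) iso_tuple_UNIV_I of_nat_le_iff order_refl)
    then show False using fin by simp
  qed
  then obtain l0 where l0: "l0 \<notin> L" by blast
  define c where "c = (LEAST l. l \<notin> L)"
  have c: "c \<notin> L" unfolding c_def using l0 by (rule LeastI)
  have L: "l \<in> L \<longleftrightarrow> l < c" for l
  proof
    assume l: "l \<in> L"
    have "c \<in> L" if "c \<le> l" using l that unfolding L_def by (simp, meson le_less_trans)
    then show "l < c" using c by force
  next
    assume "l < c"
    then show "l \<in> L" unfolding c_def using not_less_Least by blast
  qed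
  then have Lc: "L = {..<c}" by blast
  have "block_number P = (if c = 0 then - \<infinity> else ereal (real (c - 1)))"
  proof (cases "c = 0")
    case True
    then show ?thesis unfolding bn Lc by (simp add: bot_ereal_def)
  next
    case False
    have "(SUP l\<in>{..<c}. ereal (real l)) = ereal (real (c - 1))"
    proof (rule SUP_eqI)
      show "ereal (real l) \<le> ereal (real (c - 1))" if "l \<in> {..<c}" for l using that by auto
      show "ereal (real (c - 1)) \<le> y" if "\<And>l. l \<in> {..<c} \<Longrightarrow> ereal (real l) \<le> y" for y
        using that[of "c - 1"] False by simp
    qed
    then show ?thesis unfolding bn Lc using False by simp
  qed
  with L that show ?thesis unfolding L_def by blast
qed

text \<open>With more blocks than this, \<open>many_blocks_imp_many_large_blocks\<close> for
  \<open>l = c + 1\<close> would produce a sub-tournament with \<open>c + 1\<close> blocks of size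
  at least \<open>M\<close>, and it would belong to \<open>P\<close> by heredity.\<close>

lemma blocks_bounded:
  assumes P: "hereditary_property P" and m: "0 < M"
    and M: "\<And>T. T \<in> P \<Longrightarrow> num_large_blocks M T \<le> c"
  shows "\<exists>K. \<forall>T\<in>P. card (homogeneous_blocks T) \<le> K"
proof (rule exI[where x = "2 ^ (Suc c * (M * 2 ^ (2 * Suc c) + 2 * Suc c + 2))"], rule ballI, rule ccontr)
  let ?N = "2 ^ (Suc c * (M * 2 ^ (2 * Suc c) + 2 * Suc c + 2)) :: nat"
  fix T assume TP: "T \<in> P" and "\<not> card (homogeneous_blocks T) \<le> ?N"
  have T: "tournament T" using P TP unfolding hereditary_property_def by blast
  have "?N \<le> card (pverts T // same_block (parcs T) (pverts T))"
    using \<open>\<not> _\<close> homogeneous_blocks_eq[OF T] by simp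
  then obtain S where S: "S \<subseteq> pverts T" "Suc c \<le> card {B \<in> S // same_block (parcs T) S. M \<le> card B}"
    using many_blocks_imp_many_large_blocks[OF tournament_tournament_on[OF T] tournament_finite[OF T] m]
    by blast
  have "S \<noteq> {}"
  proof
    assume "S = {}"
    then have "S // same_block (parcs T) S = {}" by simp
    then show False using S(2) by simp
  qed
  then have "subtournament T S \<in> P" using hereditary_subtournament[OF P TP S(1)] by blast
  from M[OF this] S(2) show False
    unfolding homogeneous_blocks_subtournament[OF T S(1)] by simp
qed

section \<open>Shrinking large blocks to prescribed sizes\<close>

lemma quotient_Int:
  assumes eq: "equiv S E" and R: "R \<subseteq> S" and cover: "\<And>x. x \<in> S \<Longrightarrow> \<exists>r\<in>R. (x, r) \<in> E"
  shows "R // (E \<inter> R \<times> R) = (\<lambda>B. B \<inter> R) ` (S // E)"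
proof
  have cls: "(E \<inter> R \<times> R) `` {r} = E `` {r} \<inter> R" if "r \<in> R" for r using that by blast
  show "R // (E \<inter> R \<times> R) \<subseteq> (\<lambda>B. B \<inter> R) ` (S // E)"
  proof
    fix X assume "X \<in> R // (E \<inter> R \<times> R)"
    then obtain r where "r \<in> R" "X = E `` {r} \<inter> R" using cls by (metis quotientE)
    then show "X \<in> (\<lambda>B. B \<inter> R) ` (S // E)" using R by (intro image_eqI[OF _ quotientI]) auto
  qed
  show "(\<lambda>B. B \<inter> R) ` (S // E) \<subseteq> R // (E \<inter> R \<times> R)"
  proof
    fix X assume "X \<in> (\<lambda>B. B \<inter> R) ` (S // E)"
    then obtain x where x: "x \<in> S" "X = E `` {x} \<inter> R" by (auto elim: quotientE)
    obtain r where r: "r \<in> R" "(x, r) \<in> E" using cover[OF x(1)] by blast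
    then have "X = (E \<inter> R \<times> R) `` {r}" using x(2) cls equiv_class_eq[OF eq r(2)] by simp
    then show "X \<in> R // (E \<inter> R \<times> R)" using r(1) by (simp add: quotientI)
  qed
qed

text \<open>The set \<open>S\<close> keeps each small block whole and \<open>a i\<close> vertices of
  \<open>D i\<close>, so it meets every block. By \<open>same_block_subtournament\<close> its blocks
  are the traces of those of \<open>T\<close>, and none of them merge.\<close>

lemma shrink_blocks:
  fixes k M :: nat
  assumes T: "tournament T" and M: "0 < M"
    and D: "bij_betw D {..k} {B \<in> homogeneous_blocks T. M \<le> card B}"
    and a: "\<And>i. i \<le> k \<Longrightarrow> 0 < a i" "\<And>i. i \<le> k \<Longrightarrow> a i \<le> card (D i)"
    and small: "\<And>B. B \<in> homogeneous_blocks T \<Longrightarrow> card B < M \<Longrightarrow> 0 < card B"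
  obtains S where "S \<subseteq> pverts T" "S \<noteq> {}"
    "card S = card (\<Union>{B \<in> homogeneous_blocks T. card B < M}) + (\<Sum>i\<le>k. a i)"
    "card ` homogeneous_blocks (subtournament T S) =
       card ` {B \<in> homogeneous_blocks T. card B < M} \<union> a ` {..k}"
proof -
  let ?A = "parcs T" and ?V = "pverts T" and ?H = "homogeneous_blocks T"
  let ?E = "same_block ?A ?V"
  note TS = tournament_tournament_on[OF T] and fin = tournament_finite[OF T]
  note eq = equiv_same_block[OF TS] and Heq = homogeneous_blocks_eq[OF T]
  have BV: "B \<subseteq> ?V" if "B \<in> ?H" for B using in_quotient_imp_subset[OF eq] that Heq by simp
  have finB: "finite B" if "B \<in> ?H" for B using finite_subset[OF BV[OF that] fin] .
  have disj: "B \<inter> C = {}" if "B \<in> ?H" "C \<in> ?H" "B \<noteq> C" for B C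
    using quotient_disj[OF eq] that Heq by metis
  have DH: "D i \<in> ?H" "M \<le> card (D i)" if "i \<le> k" for i using bij_betwE[OF D] that by auto
  have Dinj: "i = j" if "i \<le> k" "j \<le> k" "D i = D j" for i j
    using bij_betw_imp_inj_on[OF D] that by (simp add: inj_on_eq_iff)
  have "\<exists>X\<subseteq>D i. card X = a i" if "i \<le> k" for i
    using obtain_subset_with_card_n[OF a(2)[OF that]] by metis
  then obtain X where X: "\<And>i. i \<le> k \<Longrightarrow> X i \<subseteq> D i" "\<And>i. i \<le> k \<Longrightarrow> card (X i) = a i" by metis
  let ?Sm = "{B \<in> ?H. card B < M}"
  define S where "S = \<Union>?Sm \<union> (\<Union>i\<le>k. X i)"
  have Xne: "X i \<noteq> {}" if "i \<le> k" for i using X(2)[OF that] a(1)[OF that] by auto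
  have XV: "X i \<subseteq> ?V" if "i \<le> k" for i using X(1)[OF that] BV[OF DH(1)[OF that]] by (rule subset_trans)
  have SV: "S \<subseteq> ?V"
    unfolding S_def
  proof (intro Un_least Union_least)
    show "B \<subseteq> ?V" if "B \<in> ?Sm" for B using BV[of B] that by simp
    show "Y \<subseteq> ?V" if "Y \<in> X ` {..k}" for Y using that by (elim imageE) (simp add: XV)
  qed
  have big: "\<exists>i\<le>k. B = D i" if "B \<in> ?H" "\<not> card B < M" for B
  proof -
    have "B \<in> D ` {..k}" unfolding bij_betw_imp_surj_on[OF D] using that by simp
    then show ?thesis by auto
  qed
  have IntD: "D i \<inter> S = X i" if i: "i \<le> k" for i
  proof -
    have "D i \<inter> B = {}" if "B \<in> ?Sm" for B
    proof (rule disj[OF DH(1)[OF i]])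
      show "B \<in> ?H" "D i \<noteq> B" using that DH(2)[OF i] by auto
    qed
    moreover have "D i \<inter> X j = {}" if "j \<le> k" "j \<noteq> i" for j
      using disj[OF DH(1)[OF i] DH(1)[OF that(1)]] Dinj[OF i that(1)] that(2) X(1)[OF that(1)] by blast
    ultimately show ?thesis unfolding S_def using X(1)[OF i] i by blast
  qed
  have IntB: "B \<inter> S = B" if "B \<in> ?Sm" for B using that unfolding S_def by blast
  \<comment> \<open>A small block survives entirely, and a large one keeps a vertex because
    \<open>a i\<close> is positive.\<close>
  have cover: "\<exists>r\<in>S. (x, r) \<in> ?E" if x: "x \<in> ?V" for x
  proof -
    have B: "?E `` {x} \<in> ?H" unfolding Heq using x by (rule quotientI)
    have "?E `` {x} \<inter> S \<noteq> {}"
    proof (cases "card (?E `` {x}) < M")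
      case True
      then have "?E `` {x} \<inter> S = ?E `` {x}" using IntB B by blast
      moreover have "x \<in> ?E `` {x}" using same_block_refl[OF TS x] by blast
      ultimately show ?thesis by blast
    next
      case False
      then obtain i where "i \<le> k" "?E `` {x} = D i" using big[OF B] by blast
      then show ?thesis using IntD Xne by simp
    qed
    then show ?thesis by blast
  qed
  have "homogeneous_blocks (subtournament T S) = S // (?E \<inter> S \<times> S)"
    using homogeneous_blocks_subtournament[OF T SV] same_block_subtournament[OF TS SV cover] by simp
  also have "\<dots> = (\<lambda>B. B \<inter> S) ` ?H" unfolding Heq by (rule quotient_Int[OF eq SV cover])
  finally have HS: "homogeneous_blocks (subtournament T S) = (\<lambda>B. B \<inter> S) ` ?H" .
  have H: "?H = ?Sm \<union> D ` {..k}" using big DH(1) by auto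
  have "card ` homogeneous_blocks (subtournament T S)
      = (\<lambda>B. card (B \<inter> S)) ` ?Sm \<union> (\<lambda>i. card (D i \<inter> S)) ` {..k}"
    unfolding HS image_image by (subst (1) H) (simp only: image_Un image_image)
  also have "(\<lambda>B. card (B \<inter> S)) ` ?Sm = card ` ?Sm" by (rule image_cong) (simp_all only: IntB)
  also have "(\<lambda>i. card (D i \<inter> S)) ` {..k} = a ` {..k}" by (rule image_cong) (simp_all add: IntD X(2))
  finally have cards: "card ` homogeneous_blocks (subtournament T S) = card ` ?Sm \<union> a ` {..k}" .
  have finX: "finite (X i)" if "i \<le> k" for i using finite_subset[OF X(1) finB[OF DH(1)]] that by blast
  have "card S = card (\<Union>?Sm) + card (\<Union>i\<le>k. X i)"
    unfolding S_def
  proof (rule card_Un_disjoint)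
    show "finite (\<Union>?Sm)" using finite_homogeneous_blocks[OF T] finB by (intro finite_Union) auto
    show "finite (\<Union>i\<le>k. X i)" by (intro finite_UN_I) (simp_all add: finX)
    have "B \<inter> X i = {}" if "B \<in> ?Sm" "i \<le> k" for B i
    proof -
      have "B \<in> ?H" "D i \<noteq> B" using that(1) DH(2)[OF that(2)] by auto
      then show ?thesis using disj[OF DH(1)[OF that(2)]] X(1)[OF that(2)] by blast
    qed
    then show "\<Union>?Sm \<inter> (\<Union>i\<le>k. X i) = {}" by blast
  qed
  also have "card (\<Union>i\<le>k. X i) = (\<Sum>i\<le>k. card (X i))"
  proof (rule card_UN_disjoint)
    show "\<forall>i\<in>{..k}. \<forall>j\<in>{..k}. i \<noteq> j \<longrightarrow> X i \<inter> X j = {}"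
    proof (intro ballI impI)
      fix i j assume ij: "i \<in> {..k}" "j \<in> {..k}" "i \<noteq> j"
      then have "D i \<inter> D j = {}" using disj[OF DH(1) DH(1), of i j] Dinj[of i j] by auto
      then show "X i \<inter> X j = {}" using X(1)[of i] X(1)[of j] ij by auto
    qed
  qed (use finX in auto)
  also have "\<dots> = (\<Sum>i\<le>k. a i)" by (simp add: X(2))
  finally have cardS: "card S = card (\<Union>?Sm) + (\<Sum>i\<le>k. a i)" .
  have "S \<noteq> {}" using Xne[of 0] unfolding S_def by blast
  from that[OF SV this cardS cards] show ?thesis .
qed

text \<open>From a member with \<open>k + 1\<close> blocks of at least \<open>n\<close> vertices,
  the small blocks are kept and the large ones shrunk: \<open>k\<close> sizes range freely over
  \<open>q\<close> values each, and the last brings the total to \<open>n\<close>. In the condition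
  on \<open>n\<close>, the term \<open>K * M\<close> leaves room for the small blocks, and
  \<open>M + k * q\<close> is allotted to each of the \<open>k + 1\<close> others.\<close>

lemma level_card_ge:
  assumes P: "hereditary_property P" and M: "0 < M"
    and large: "\<And>T. T \<in> P \<Longrightarrow> num_large_blocks M T \<le> Suc k"
    and K: "\<And>T. T \<in> P \<Longrightarrow> card (homogeneous_blocks T) \<le> K"
    and unbounded: "\<And>m. \<exists>T\<in>P. k < num_large_blocks m T"
    and fin: "finite (level P n)" and n: "K * M + Suc k * (M + k * q) \<le> n"
  shows "q ^ k \<le> card (level P n)"
proof -
  have tour: "\<And>T. T \<in> P \<Longrightarrow> tournament T" using P unfolding hereditary_property_def by blast
  obtain T where TP: "T \<in> P" and Tn: "k < num_large_blocks n T" using unbounded by blast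
  have T: "tournament T" using tour[OF TP] .
  let ?H = "homogeneous_blocks T"
  have finH: "finite ?H" using finite_homogeneous_blocks[OF T] .
  let ?Big = "{B \<in> ?H. M \<le> card B}" and ?Sm = "{B \<in> ?H. card B < M}"
  have "Suc k * (M + k * q) = M + k * q + k * (M + k * q)" by simp
  then have Mn: "M + k * q \<le> n" using n by linarith
  \<comment> \<open>At most \<open>k + 1\<close> blocks reach size \<open>M\<close>, while more than
    \<open>k\<close> reach \<open>n\<close>; so the two families coincide and every large block has
    room for any size up to \<open>n\<close>.\<close>
  have "{B \<in> ?H. n \<le> card B} \<subseteq> ?Big" using Mn by auto
  moreover have "card ?Big \<le> card {B \<in> ?H. n \<le> card B}" using large[OF TP] Tn by linarith
  ultimately have Big: "{B \<in> ?H. n \<le> card B} = ?Big" using finH by (intro card_seteq) auto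
  have "card ?Big = Suc k" using large[OF TP] Tn Big by simp
  then obtain D where D: "bij_betw D {..k} ?Big"
    using finH ex_bij_betw_nat_finite[of ?Big] by (auto simp: lessThan_atLeast0[symmetric] lessThan_Suc_atMost)
  have Dn: "n \<le> card (D i)" if "i \<le> k" for i using bij_betwE[OF D] that Big by blast
  define r where "r = card (\<Union>?Sm)"
  have "r \<le> (\<Sum>B\<in>?Sm. card B)" unfolding r_def by (rule card_Union_le_sum_card)
  also have "\<dots> \<le> of_nat (card ?Sm) * M" by (rule sum_bounded_above) simp
  also have "\<dots> \<le> K * M"
    using card_mono[OF finH, of ?Sm] K[OF TP] by (simp add: mult_le_mono1)
  finally have r: "r \<le> K * M" .
  note TS = tournament_tournament_on[OF T]
  note eq = equiv_same_block[OF TS] and Heq = homogeneous_blocks_eq[OF T]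
  have pos: "0 < card B" if "B \<in> ?H" for B
    using in_quotient_imp_non_empty[OF eq] in_quotient_imp_subset[OF eq]
      finite_subset[OF _ tournament_finite[OF T]] that unfolding Heq by (simp add: card_gt_0_iff)
  let ?B = "{..<k} \<rightarrow>\<^sub>E {..<q}"
  \<comment> \<open>The sizes lie in pairwise disjoint ranges above \<open>M\<close>, so that \<open>b\<close> can be read off from the set
    of all block sizes.\<close>
  define a where "a = (\<lambda>b i. if i < k then M + i * q + b i else n - r - (\<Sum>i<k. M + i * q + b i))"
    for b :: "nat \<Rightarrow> nat"
  have a_lt: "M + i * q \<le> a b i" "a b i < M + Suc i * q" "a b i < M + k * q" if "b \<in> ?B" "i < k" for b i
  proof -
    have "b i < q" using that by auto
    then show "M + i * q \<le> a b i" and lt: "a b i < M + Suc i * q" using that(2) by (auto simp: a_def)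
    have "Suc i * q \<le> k * q" using that(2) by (intro mult_le_mono1) simp
    then show "a b i < M + k * q" using lt by linarith
  qed
  have sum_le: "(\<Sum>i<k. M + i * q + b i) \<le> k * (M + k * q)" if b: "b \<in> ?B" for b
  proof -
    have "(\<Sum>i<k. M + i * q + b i) = (\<Sum>i<k. a b i)" by (rule sum.cong) (simp_all add: a_def)
    also have "\<dots> \<le> of_nat (card {..<k}) * (M + k * q)"
      using a_lt(3)[OF b] by (intro sum_bounded_above) (simp add: less_imp_le)
    finally show ?thesis by simp
  qed
  \<comment> \<open>The last block takes what the others leave. The condition on \<open>n\<close>
    makes the subtractions exact and puts this size above all the other ranges.\<close>
  have a_k: "M + k * q \<le> a b k" "a b k \<le> n" "r + (\<Sum>i\<le>k. a b i) = n" if b: "b \<in> ?B" for b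
  proof -
    have ak: "a b k = n - r - (\<Sum>i<k. M + i * q + b i)" by (simp add: a_def)
    have "r + (\<Sum>i<k. M + i * q + b i) + (M + k * q) \<le> n"
      using sum_le[OF b] r n unfolding mult_Suc by linarith
    then show "M + k * q \<le> a b k" "a b k \<le> n"
      unfolding ak by linarith+
    have "(\<Sum>i\<le>k. a b i) = (\<Sum>i<k. a b i) + a b k" by (simp flip: lessThan_Suc_atMost)
    also have "(\<Sum>i<k. a b i) = (\<Sum>i<k. M + i * q + b i)" by (rule sum.cong) (simp_all add: a_def)
    finally show "r + (\<Sum>i\<le>k. a b i) = n"
      using \<open>r + _ + _ \<le> n\<close> unfolding ak by linarith
  qed
  have "\<exists>S. S \<subseteq> pverts T \<and> S \<noteq> {} \<and> card S = n \<and>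
      card ` homogeneous_blocks (subtournament T S) = card ` ?Sm \<union> a b ` {..k}" if b: "b \<in> ?B" for b
  proof -
    have le: "M \<le> a b i \<and> a b i \<le> n" if "i \<le> k" for i
    proof (cases "i < k")
      case True
      then show ?thesis using a_lt(1,3)[OF b True] Mn by linarith
    next
      case False
      then have "i = k" using that by simp
      then show ?thesis using a_k(1,2)[OF b] by simp
    qed
    have le': "0 < a b i" "a b i \<le> card (D i)" if "i \<le> k" for i
      using le[OF that] M Dn[OF that] by linarith+
    obtain S where S: "S \<subseteq> pverts T" "S \<noteq> {}" "card S = card (\<Union>?Sm) + (\<Sum>i\<le>k. a b i)"
        "card ` homogeneous_blocks (subtournament T S) = card ` ?Sm \<union> a b ` {..k}"
      using shrink_blocks[OF T M D le' pos] by blast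
    then show ?thesis using a_k(3)[OF b] by (intro exI[of _ S]) (simp add: r_def)
  qed
  then have "\<exists>S. \<forall>b\<in>?B. S b \<subseteq> pverts T \<and> S b \<noteq> {} \<and> card (S b) = n \<and>
      card ` homogeneous_blocks (subtournament T (S b)) = card ` ?Sm \<union> a b ` {..k}"
    by (intro bchoice ballI)
  then obtain S where S_all: "\<forall>b\<in>?B. S b \<subseteq> pverts T \<and> S b \<noteq> {} \<and> card (S b) = n \<and>
      card ` homogeneous_blocks (subtournament T (S b)) = card ` ?Sm \<union> a b ` {..k}"
    by (rule exE)
  have S: "S b \<subseteq> pverts T" "S b \<noteq> {}" "card (S b) = n"
      "card ` homogeneous_blocks (subtournament T (S b)) = card ` ?Sm \<union> a b ` {..k}" if "b \<in> ?B" for b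
    using bspec[OF S_all that] by argo+
  let ?F = "\<lambda>b. iso_rel `` {subtournament T (S b)}"
  have "inj_on ?F ?B"
  proof (rule inj_onI)
    fix b c assume b: "b \<in> ?B" and c: "c \<in> ?B" and F: "?F b = ?F c"
    have Tb: "tournament (subtournament T (S b))" and Tc: "tournament (subtournament T (S c))"
      using tournament_subtournament[OF T S(1)] b c by blast+
    have "digraph_iso (with_proj (subtournament T (S c))) (with_proj (subtournament T (S c)))"
      by (rule bij_digraph_iso[OF Tc Tc, of id]) simp_all
    then have "subtournament T (S c) \<in> ?F c" by (simp add: iso_rel_def)
    then have "digraph_iso (with_proj (subtournament T (S b))) (with_proj (subtournament T (S c)))"
      unfolding F[symmetric] by (simp add: iso_rel_def)
    then obtain f where f: "bij_betw f (S b) (S c)"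
      "\<And>x y. x \<in> S b \<Longrightarrow> y \<in> S b \<Longrightarrow>
         (f x, f y) \<in> parcs (subtournament T (S c)) \<longleftrightarrow> (x, y) \<in> parcs (subtournament T (S b))"
      using digraph_iso_bij[OF Tb Tc] by (metis subtournament_simps(1))
    have Z: "card ` ?Sm \<union> a b ` {..k} = card ` ?Sm \<union> a c ` {..k}"
      using block_cards_image[OF f] homogeneous_blocks_eq[OF Tb] homogeneous_blocks_eq[OF Tc] S(4)[OF b] S(4)[OF c]
      by simp
    \<comment> \<open>The size \<open>a b i\<close> is at least \<open>M\<close>, so it is not that
      of a small block, and below \<open>M + k * q\<close>, so it is not the last size for
      \<open>c\<close>. Among the other ranges only the one with index \<open>i\<close> contains
      it.\<close>
    have "b i = c i" if i: "i < k" for i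
    proof -
      have "a b i \<in> a b ` {..k}" using i by simp
      then have "a b i \<in> card ` ?Sm \<union> a c ` {..k}" unfolding Z[symmetric] by (rule UnI2)
      moreover have "a b i \<notin> card ` ?Sm" using a_lt(1)[OF b i] by auto
      ultimately obtain j where j: "j \<le> k" "a b i = a c j" by blast
      have "j < k" using a_k(1)[OF c] a_lt(3)[OF b i] j by (metis le_neq_implies_less not_less)
      note ranges = a_lt(1,2)[OF b i] a_lt(1,2)[OF c this]
      have "\<not> i < j" "\<not> j < i"
        using ranges j(2) mult_le_mono1[of "Suc i" j q] mult_le_mono1[of "Suc j" i q] by linarith+
      then have "a b i = a c i" using j(2) by (metis linorder_neqE_nat)
      then show ?thesis using i by (simp add: a_def)
    qed
    then show "b = c" using PiE_ext[OF b c] by blast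
  qed
  moreover have "?F ` ?B \<subseteq> level P n"
  proof
    fix Y assume "Y \<in> ?F ` ?B"
    then obtain b where b: "b \<in> ?B" "Y = ?F b" by blast
    then show "Y \<in> level P n"
      unfolding level_def using hereditary_subtournament[OF P TP S(1,2)[OF b(1)]] S(3)[OF b(1)]
      by (simp add: quotientI)
  qed
  ultimately have "card ?B \<le> card (level P n)" using fin by (metis card_inj_on_le)
  then show ?thesis by (simp add: card_PiE)
qed

text \<open>With at most \<open>K\<close> blocks, none of them large, a member has at most
  \<open>K * M\<close> vertices. This settles the case where the supremum is over the empty
  set.\<close>

lemma level_eventually_empty:
  assumes P: "hereditary_property P"
    and K: "\<And>T. T \<in> P \<Longrightarrow> card (homogeneous_blocks T) \<le> K"
    and M: "\<And>T. T \<in> P \<Longrightarrow> num_large_blocks M T = 0" and n: "K * M < n"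
  shows "level P n = {}"
proof -
  have "card (pverts T) \<noteq> n" if TP: "T \<in> P" for T
  proof -
    have T: "tournament T" using P TP unfolding hereditary_property_def by blast
    let ?H = "homogeneous_blocks T"
    have finH: "finite ?H" using finite_homogeneous_blocks[OF T] .
    have "{B \<in> ?H. M \<le> card B} = {}" using M[OF TP] finH by simp
    then have small: "card B \<le> M" if "B \<in> ?H" for B using that by fastforce
    have "card (pverts T) = card (\<Union>?H)"
      using Union_quotient[OF equiv_same_block[OF tournament_tournament_on[OF T]]]
        homogeneous_blocks_eq[OF T] by simp
    also have "\<dots> \<le> (\<Sum>B\<in>?H. card B)" by (rule card_Union_le_sum_card)
    also have "\<dots> \<le> of_nat (card ?H) * M" using small by (rule sum_bounded_above)
    also have "\<dots> \<le> K * M" using K[OF TP] by (simp add: mult_le_mono1)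
    finally show ?thesis using n by simp
  qed
  then have "{T \<in> P. card (pverts T) = n} = {}" by blast
  then show ?thesis unfolding level_def by simp
qed

section \<open>Combining the upper and the lower bound\<close>

theorem theorem2:
  fixes P :: "nat pair_pre_digraph set" and k :: ereal
  assumes "hereditary_property P"
    and "k = block_number P" and "k < \<infinity>"
  shows "(\<lambda>n. real (card (level P n))) \<in>
           \<Theta>(\<lambda>n. if k = - \<infinity> then 0 else real n powr real_of_ereal k)"
proof -
  note P = assms(1)
  have tour: "\<And>T. T \<in> P \<Longrightarrow> tournament T" using P unfolding hereditary_property_def by blast
  obtain c where c: "\<And>l. (\<forall>m. \<exists>T\<in>P. l < num_large_blocks m T) \<longleftrightarrow> l < c"
    and k: "k = (if c = 0 then - \<infinity> else ereal (real (c - 1)))"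
    using block_number_cases[OF P] assms(2,3) by metis
  obtain M0 where M0: "\<And>T. T \<in> P \<Longrightarrow> num_large_blocks M0 T \<le> c"
    using c[of c] by (meson less_irrefl not_le)
  \<comment> \<open>The threshold is raised by one to make it positive, as the pigeonhole argument
    and the shrinking require.\<close>
  define M where "M = Suc M0"
  have M: "num_large_blocks M T \<le> c" if "T \<in> P" for T
    using num_large_blocks_antimono[OF tour[OF that], of M0 M] M0[OF that] by (simp add: M_def)
  have Mpos: "0 < M" by (simp add: M_def)
  obtain K where K: "\<And>T. T \<in> P \<Longrightarrow> card (homogeneous_blocks T) \<le> K"
    using blocks_bounded[OF P Mpos M] by blast
  show ?thesis
  proof (cases "c = 0")
    case True
    \<comment> \<open>Without admissible \<open>l\<close> both sides are eventually zero.\<close>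
    have "level P n = {}" if "K * M < n" for n
      using M True by (intro level_eventually_empty[OF P K _ that]) auto
    note empty = this
    have "eventually (\<lambda>n. real (card (level P n)) = 0) at_top"
      using eventually_gt_at_top[of "K * M"] by eventually_elim (simp add: empty)
    moreover have "k = - \<infinity>" using k True by simp
    ultimately show ?thesis by (intro bigthetaI_cong) (simp only: if_True simp_thms)
  next
    case False
    then obtain j where j: "c = Suc j" by (cases c) auto
    have M': "num_large_blocks M T \<le> Suc j" if "T \<in> P" for T using M[OF that] j by simp
    obtain C where C: "\<And>n. finite (level P n)" "\<And>n. card (level P n) \<le> C * (n + 1) ^ j"
      using card_level_le[OF P K M'] by blast
    have unb: "\<exists>T\<in>P. j < num_large_blocks m T" for m using c[of j] j by blast
    \<comment> \<open>With \<open>q = n div d\<close> the part of the size condition that involves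
      \<open>q\<close> takes at most \<open>n / 2\<close>, and \<open>N\<close> makes the constant
      part at most \<open>n / 2\<close> as well. The square, in place of \<open>Suc j * j\<close>,
      keeps \<open>d\<close> positive for \<open>j = 0\<close>; the summand \<open>2 * d\<close> in
      \<open>N\<close> makes \<open>q\<close> at least \<open>n / (2 * d)\<close>.\<close>
    define d where "d = 2 * (Suc j * Suc j)"
    define N where "N = 2 * (K * M + Suc j * M) + 2 * d"
    have lower: "real n ^ j \<le> (2 * real d) ^ j * real (card (level P n))" if n: "N \<le> n" for n
    proof -
      let ?q = "n div d"
      have dpos: "0 < d" by (simp add: d_def)
      have "2 * (Suc j * j) \<le> d" by (simp add: d_def)
      then have "2 * (Suc j * j) * ?q \<le> d * ?q" by (rule mult_le_mono1)
      also have "\<dots> \<le> n" by simp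
      finally have "2 * (Suc j * (j * ?q)) \<le> n" by (simp only: mult.assoc)
      moreover have "2 * (K * M + Suc j * M) \<le> n" using n by (simp add: N_def)
      moreover have "Suc j * (M + j * ?q) = Suc j * M + Suc j * (j * ?q)" by (rule distrib_left)
      moreover have "2 * y \<le> n \<Longrightarrow> 2 * (x + z) \<le> n \<Longrightarrow> w = z + y \<Longrightarrow> x + w \<le> n" for w x y z :: nat
        by presburger
      ultimately have "K * M + Suc j * (M + j * ?q) \<le> n" by blast
      note n_large = this
      have q: "?q ^ j \<le> card (level P n)"
      proof (rule level_card_ge[OF P Mpos _ _ unb C(1) n_large])
        show "num_large_blocks M T \<le> Suc j" "card (homogeneous_blocks T) \<le> K" if "T \<in> P" for T
          using M'[OF that] K[OF that] by blast+
      qed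
      have "n < d * ?q + d" using dpos by (metis add.commute mult_div_mod_eq mod_less_divisor add_less_cancel_left)
      moreover have "d \<le> n div 2" using n by (simp add: N_def)
      ultimately have "n \<le> 2 * d * ?q" by linarith
      then have "real n \<le> 2 * real d * real ?q" by (metis of_nat_le_iff of_nat_mult of_nat_numeral)
      then have "real n ^ j \<le> (2 * real d * real ?q) ^ j" by (rule power_mono) simp
      also have "\<dots> = (2 * real d) ^ j * real (?q ^ j)" by (simp add: power_mult_distrib)
      also have "\<dots> \<le> (2 * real d) ^ j * real (card (level P n))"
        using q by (intro mult_left_mono) simp_all
      finally show ?thesis .
    qed
    have upper: "real (card (level P n)) \<le> real C * 2 ^ j * real n ^ j" if n: "1 \<le> n" for n
    proof -
      have "real (card (level P n)) \<le> real (C * (n + 1) ^ j)" using C(2) by (simp only: of_nat_le_iff)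
      also have "\<dots> = real C * (1 + real n) ^ j" by simp
      also have "\<dots> \<le> real C * (2 * real n) ^ j"
        using n by (intro mult_left_mono power_mono) simp_all
      finally show ?thesis by (simp add: power_mult_distrib)
    qed
    have "(\<lambda>n. real (card (level P n))) \<in> \<Theta>(\<lambda>n. real n ^ j)"
    proof (rule bigthetaI)
      show "(\<lambda>n. real (card (level P n))) \<in> O(\<lambda>n. real n ^ j)"
        by (rule bigoI[of _ "real C * 2 ^ j"])
          (use eventually_ge_at_top[of 1] in eventually_elim, use upper in simp)
      have "(\<lambda>n. real n ^ j) \<in> O(\<lambda>n. real (card (level P n)))"
        by (rule bigoI[of _ "(2 * real d) ^ j"])
          (use eventually_ge_at_top[of N] in eventually_elim, use lower in simp)
      then show "(\<lambda>n. real (card (level P n))) \<in> \<Omega>(\<lambda>n. real n ^ j)"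
        by (simp add: bigomega_iff_bigo)
    qed
    moreover have "(\<lambda>n. real n ^ j) \<in> \<Theta>(\<lambda>n. if k = - \<infinity> then 0 else real n powr real_of_ereal k)"
    proof (rule bigthetaI_cong)
      \<comment> \<open>Equality is claimed only eventually: at \<open>n = 0\<close> and
        \<open>j = 0\<close> the power is 1, whereas \<open>powr\<close> gives 0.\<close>
      show "\<forall>\<^sub>F n in sequentially. real n ^ j = (if k = - \<infinity> then 0 else real n powr real_of_ereal k)"
        using eventually_gt_at_top[of 0] by eventually_elim (simp add: k j powr_realpow)
    qed
    ultimately show ?thesis by (rule landau_theta.trans)
  qed
qed

end
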